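(* Let $L$ be a positive definite even lattice of rank $\ell$, $p\ge2$ an integer, and $\sigma$ an isometry of $L$ of order $p$ which is fixed-point-free on $L$. Let $\widehat\sigma\in\mathrm{Aut}(V_L)$ be a lift of $\sigma$, and let $V_L^T=M(1)(\sigma)\otimes T$ be the $\widehat\sigma$-twisted $V_L$-module associated with a finite dimensional $\widehat L_\sigma$-module $T$ satisfying $\kappa_s=\xi_s\,\mathrm{id}_T$ and $at=\widehat\sigma(a)t$ for $a\in\widehat L_\sigma$, $t\in T$. Then the quantum dimension $\mathrm{qdim}_{V_L}V_L^T$ exists and $$\mathrm{qdim}_{V_L}V_L^T=\frac{v\,\dim T}{\sqrt{\prod_{d\mid p}d^{m_d}}},$$ where $v=\mathrm{vol}(\mathbb{R}^\ell/L)$ and the integers $m_d$ are defined by $\det(x-\sigma)=\prod_{d\mid p}(x^d-1)^{m_d}$.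
   Context: $V_L$ is the lattice vertex operator algebra of $L$; its character is $Z_{V_L}(\tau)=\Theta_L(\tau)/\eta(\tau)^\ell$ with $\Theta_L(\tau)=\sum_{\alpha\in L}q^{\langle\alpha,\alpha\rangle/2}$, $q=e^{2\pi\sqrt{-1}\tau}$. For a (twisted) $V$-module $M$ the character is $Z_M(\tau)=\mathrm{tr}_M q^{L_0-c_V/24}$, and the quantum dimension is $\mathrm{qdim}_V M=\lim_{y\to0^+}Z_M(\sqrt{-1}y)/Z_V(\sqrt{-1}y)$ when the limit exists. Let $s=p$ if $p$ is even and $s=2p$ if $p$ is odd, $\xi_s$ a primitive $s$-th root of unity, and $c^\sigma(\alpha,\beta)=\frac{s}{p}\sum_{i=1}^{p-1}\langle i\sigma^i(\alpha),\beta\rangle+s\mathbb{Z}$; $\widehat L_\sigma$ is the central extension $1\to\langle\kappa_s\rangle\to\widehat L_\sigma\to L\to1$ by a cyclic group of order $s$ with commutator $aba^{-1}b^{-1}=\kappa_s^{c^\sigma(\bar a,\bar b)}$, on which $\widehat\sigma$ acts as an automorphism lifting $\sigma$. $M(1)(\sigma)$ is the $\sigma$-twisted module of the Heisenberg VOA on $\mathfrak h=\mathbb{C}\otimes L$ (induced from the twisted affine algebra $\bigoplus_{i=1}^{p-1}\mathfrak h^{(i;\sigma)}\otimes t^{i/p}\mathbb{C}[t,t^{-1}]\oplus\mathbb{C}K$, where $\mathfrak h^{(i;\sigma)}=\{u\mid\sigma u=\xi_p^{-i}u\}$, $r_i=\dim\mathfrak h^{(i;\sigma)}$), with character $Z_{M(1)(\sigma)}(\tau)=q^{\rho-\ell/24}\big/\prod_{i=1}^{p-1}\prod_{n\ge0}(1-q^{i/p+n})^{r_{p-i}}$,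 $\rho=\frac{1}{4p^2}\sum_{i=1}^{p-1}i(p-i)r_i$; the $\widehat\sigma$-twisted module $V_L^T=M(1)(\sigma)\otimes T$ has character $\dim T\cdot Z_{M(1)(\sigma)}(\tau)$. *)

theory Defs
  imports "HOL-Analysis.Analysis"
begin

text \<open>The lattice of rank l = CARD('n) spanned by the columns of an invertible real matrix B,
  inside R^l with its standard (positive definite) inner product.\<close>
definition lattice_of :: "real^'n^'n \<Rightarrow> (real^'n) set" where
  "lattice_of B = {B *v z | z. \<forall>i. z $ i \<in> \<int>}"

definition even_lattice :: "(real^'n) set \<Rightarrow> bool" where
  "even_lattice L \<longleftrightarrow> (\<forall>a\<in>L. \<forall>b\<in>L. a \<bullet> b \<in> \<int>) \<and> (\<forall>a\<in>L. \<exists>k::int. a \<bullet> a = 2 * of_int k)"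

text \<open>q = e^{2 pi i tau} at tau = i y, i.e. q = exp(-2 pi y); q^r = exp(-2 pi y r).\<close>
definition qpow :: "real \<Rightarrow> real \<Rightarrow> real" where
  "qpow y r = exp (- 2 * pi * y * r)"

definition theta_L :: "(real^'n) set \<Rightarrow> real \<Rightarrow> real" where
  "theta_L L y = infsum (\<lambda>\<alpha>. qpow y ((\<alpha> \<bullet> \<alpha>) / 2)) L"

definition dedekind_eta :: "real \<Rightarrow> real" where
  "dedekind_eta y = qpow y (1/24) * prodinf (\<lambda>n. 1 - qpow y (real (Suc n)))"

definition Z_VL :: "(real^'n) set \<Rightarrow> real \<Rightarrow> real" where
  "Z_VL L y = theta_L L y / dedekind_eta y ^ CARD('n)"

text \<open>r_i = dim_C of h^{(i;sigma)} = {u in C (x) L | sigma u = xi_p^{-i} u}, xi_p = e^{2 pi i/p}.\<close>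
definition r_dim :: "(real^'n \<Rightarrow> real^'n) \<Rightarrow> nat \<Rightarrow> nat \<Rightarrow> nat" where
  "r_dim \<sigma> p i = vec.dim {u :: complex^'n.
      (\<chi> a b. complex_of_real (matrix \<sigma> $ a $ b)) *v u = cis (- 2 * pi * real i / real p) *s u}"

definition rho :: "(real^'n \<Rightarrow> real^'n) \<Rightarrow> nat \<Rightarrow> real" where
  "rho \<sigma> p = 1 / (4 * real p ^ 2) * (\<Sum>i = 1..p-1. real i * real (p - i) * real (r_dim \<sigma> p i))"

definition Z_M1 :: "(real^'n \<Rightarrow> real^'n) \<Rightarrow> nat \<Rightarrow> real \<Rightarrow> real" where
  "Z_M1 \<sigma> p y = qpow y (rho \<sigma> p - real CARD('n) / 24) /
     (\<Prod>i = 1..p-1. prodinf (\<lambda>n. (1 - qpow y (real i / real p + real n)) ^ r_dim \<sigma> p (p - i)))"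

definition Z_VLT :: "(real^'n \<Rightarrow> real^'n) \<Rightarrow> nat \<Rightarrow> nat \<Rightarrow> real \<Rightarrow> real" where
  "Z_VLT \<sigma> p dimT y = real dimT * Z_M1 \<sigma> p y"

definition qdim_is :: "(real \<Rightarrow> real) \<Rightarrow> (real \<Rightarrow> real) \<Rightarrow> real \<Rightarrow> bool" where
  "qdim_is ZM ZV c \<longleftrightarrow> ((\<lambda>y. ZM y / ZV y) \<longlongrightarrow> c) (at_right 0)"

end

theory Submission
  imports Defs "HOL-Probability.Probability" "HOL-Real_Asymp.Real_Asymp"
begin

text \<open>
  Write \<open>t = 2 \<pi> y\<close>, \<open>E t a = \<Prod>n. 1 - exp (- t (a + n))\<close> and \<open>l\<close> for the rank. The quotient of characters is
  \<open>dim T \<cdot> q^\<rho> \<cdot> F t / \<Theta>\<close> with \<open>F t = \<Prod>i. (E t 1 / E t (i/p))^r_i\<close>, the exponents \<open>r_i\<close> adding up to \<open>l\<close>.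
  Since \<open>\<sigma>\<close> is real, \<open>r_i = r_{p-i}\<close>, so \<open>(F t)^2\<close> is a product of the quantities
  \<open>P t x = (E t 1)^2 / (E t x \<cdot> E t (1 - x))\<close>, a q-analogue of \<open>\<Gamma>(x) \<Gamma>(1 - x)\<close>:
  log-concavity of \<open>u \<mapsto> 1 - exp (- t u)\<close> squeezes the tails of \<open>P t x\<close> between telescoping products,
  and the product formula for the sine gives \<open>t \<cdot> P t x \<longlongrightarrow> \<pi> / sin (\<pi> x)\<close>. No modularity of \<open>\<eta>\<close> is needed.
  As \<open>\<bar>1 - \<xi>^i\<bar> = 2 sin (\<pi> i / p)\<close>, the limits combine to \<open>y^(l/2) F \<longlongrightarrow> 1 / sqrt (det (1 - \<sigma>))\<close>,
  and \<open>det (1 - \<sigma>) = \<Prod>d^m_d\<close> follows from the characteristic polynomial as \<open>x \<longlongrightarrow> 1\<close>.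
  Finally \<open>y^(l/2) \<Theta> \<longlongrightarrow> 1 / vol\<close>, because the theta series is a Riemann sum of a Gaussian.
\<close>

section \<open>A q-analogue of the reflection formula\<close>

text \<open>With q = exp (- t) this is the q-Pochhammer symbol of q^a. At \<open>a = 1\<close> it is
  the eta function without its power of q, at \<open>a = i/p\<close> it gives the denominators of
  the twisted Heisenberg character.\<close>

definition euler_prod :: "real \<Rightarrow> real \<Rightarrow> real" where
  "euler_prod t a = prodinf (\<lambda>n. 1 - exp (- t * (a + real n)))"

lemma convergent_euler_prod:
  assumes "t > 0" "a > 0"
  shows "convergent_prod (\<lambda>n. 1 - exp (- t * (a + real n)))"
proof -
  have "summable (\<lambda>n. exp (- t * a) * exp (- t) ^ n)"
    using assms by (intro summable_mult summable_geometric) auto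
  also have "(\<lambda>n. exp (- t * a) * exp (- t) ^ n) = (\<lambda>n. norm (1 - exp (- t * (a + real n)) - 1))"
    by (auto simp: fun_eq_iff simp flip: exp_of_nat_mult exp_add) (simp add: algebra_simps)
  finally show ?thesis
    by (intro abs_convergent_prod_imp_convergent_prod) (simp add: abs_convergent_prod_conv_summable)
qed

lemma one_minus_exp_pos: "t > 0 \<Longrightarrow> a > 0 \<Longrightarrow> 1 - exp (- t * a) > (0::real)"
  by simp

lemma euler_prod_pos:
  assumes "t > 0" "a > 0"
  shows "euler_prod t a > 0"
  unfolding euler_prod_def using assms
  by (intro less_0_prodinf convergent_euler_prod one_minus_exp_pos) auto

lemma euler_prod_LIMSEQ:
  assumes "t > 0" "a > 0"
  shows "(\<lambda>N. \<Prod>n<N. 1 - exp (- t * (a + real n))) \<longlonglongrightarrow> euler_prod t a"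
  using convergent_prod_LIMSEQ[OF convergent_euler_prod[OF assms]]
  unfolding euler_prod_def lessThan_Suc_atMost[symmetric] by (rule LIMSEQ_imp_Suc)

section \<open>Telescoping bounds for the partial products\<close>

definition refl_factor :: "real \<Rightarrow> real \<Rightarrow> nat \<Rightarrow> real" where
  "refl_factor t x n = (1 - exp (- t * (1 + real n)))\<^sup>2 /
     ((1 - exp (- t * (x + real n))) * (1 - exp (- t * (1 - x + real n))))"

text \<open>The right side minus the left is the square of exp (- t u / 2) - exp (- t v /
  2).\<close>

lemma one_minus_exp_log_concave:
  fixes t :: real
  assumes "t > 0" "u > 0" "v > 0"
  shows "(1 - exp (- t * u)) * (1 - exp (- t * v)) \<le> (1 - exp (- t * ((u + v) / 2)))\<^sup>2"
proof -
  have "exp (- t * u) = exp (- t * u / 2) ^ 2" "exp (- t * v) = exp (- t * v / 2) ^ 2"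
    "exp (- t * ((u + v) / 2)) = exp (- t * u / 2) * exp (- t * v / 2)"
    by (simp_all add: power2_eq_square exp_add[symmetric] field_simps)
  then have "(1 - exp (- t * ((u + v) / 2)))\<^sup>2 - (1 - exp (- t * u)) * (1 - exp (- t * v))
      = (exp (- t * u / 2) - exp (- t * v / 2))\<^sup>2"
    by (simp add: power2_eq_square algebra_simps)
  then show ?thesis
    by (smt (verit) zero_le_power2)
qed

lemma refl_factor_pos: "t > 0 \<Longrightarrow> 0 < x \<Longrightarrow> x < 1 \<Longrightarrow> refl_factor t x n > 0"
  unfolding refl_factor_def by (intro divide_pos_pos mult_pos_pos zero_less_power one_minus_exp_pos) auto

text \<open>The arguments x + n and 1 - x + n have the same sum as n and n + 1 and lie between them,
  so their product of values is the larger one. The bound is a quotient of consecutive values, so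
  that it telescopes; n > 0 keeps its denominator away from 0.\<close>

lemma refl_factor_le:
  assumes "t > 0" "0 < x" "x < 1" "n > 0"
  shows "refl_factor t x n \<le> (1 - exp (- t * (real n + 1))) / (1 - exp (- t * real n))"
proof -
  let ?f = "\<lambda>u. 1 - exp (- t * u)"
  have pos: "?f u > 0" if "u > 0" for u
    using one_minus_exp_pos that assms by blast
  \<comment> \<open>This product is exactly the difference of the two denominators to be
    compared.\<close>
  have "0 \<le> exp (- t * n) * ((1 - exp (- t * x)) * (1 - exp (- t * (1 - x))))"
    using pos[of x] pos[of "1-x"] assms by simp
  also have "\<dots> = ?f (x + n) * ?f (1 - x + n) - ?f n * ?f (n + 1)"
    by (simp add: algebra_simps flip: exp_add)
  finally have "?f n * ?f (n + 1) \<le> ?f (x + n) * ?f (1 - x + n)" by simp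
  then have "?f (n + 1) ^ 2 / (?f (x + n) * ?f (1 - x + n)) \<le> ?f (n + 1) ^ 2 / (?f n * ?f (n + 1))"
    using pos[of n] pos[of "n+1"] assms by (intro divide_left_mono mult_pos_pos pos) auto
  also have "\<dots> = ?f (n + 1) / ?f n"
    using pos[of "n+1"] by (simp add: power2_eq_square)
  finally show ?thesis
    unfolding refl_factor_def by (simp add: add.commute)
qed

text \<open>Log-concavity is used twice: n + 1/2 is the midpoint of x + n and 1 - x + n, and n + 1
  is the midpoint of n + 1/2 and n + 3/2. This bound telescopes along half-integers.\<close>

lemma refl_factor_ge:
  assumes "t > 0" "0 < x" "x < 1"
  shows "refl_factor t x n \<ge> (1 - exp (- t * (real n + 3/2))) / (1 - exp (- t * (real n + 1/2)))"
proof -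
  let ?f = "\<lambda>u. 1 - exp (- t * u)"
  have pos: "?f u > 0" if "u > 0" for u
    using one_minus_exp_pos that assms by blast
  have 1: "?f (x + n) * ?f (1 - x + n) \<le> ?f (n + 1/2) ^ 2"
  proof -
    have eq: "(x + real n + (1 - x + real n)) / 2 = real n + 1/2" by (simp add: field_simps)
    show ?thesis
      using one_minus_exp_log_concave[of t "x + n" "1 - x + n"] assms unfolding eq by simp
  qed
  have 2: "?f (n + 1/2) * ?f (n + 3/2) \<le> ?f (n + 1) ^ 2"
  proof -
    have eq: "(real n + 1/2 + (real n + 3/2)) / 2 = real n + 1" by simp
    show ?thesis
      using one_minus_exp_log_concave[of t "n + 1/2" "n + 3/2"] assms unfolding eq by (simp add: add_ac)
  qed
  have "?f (n + 3/2) / ?f (n + 1/2) = ?f (n + 1/2) * ?f (n + 3/2) / ?f (n + 1/2) ^ 2"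
    using pos[of "n+1/2"] by (simp add: power2_eq_square)
  also have "\<dots> \<le> ?f (n + 1) ^ 2 / (?f (x + n) * ?f (1 - x + n))"
    using 1 2 assms by (intro frac_le mult_pos_pos pos zero_le_power2) auto
  finally show ?thesis
    unfolding refl_factor_def by (simp add: add.commute)
qed

lemma cancel_middle: "b \<noteq> 0 \<Longrightarrow> (P * (b / c)) * (a / b) = P * (a / c)" for a b c P :: real
  by simp

text \<open>The bounds of \<open>refl_factor_le\<close> for the indices from N to M - 1 telescope;
  at N = 0 the remaining denominator would vanish.\<close>

lemma prod_refl_factor_le:
  assumes "t > 0" "0 < x" "x < 1" "N > 0" "N \<le> M"
  shows "(\<Prod>n<M. refl_factor t x n) \<le> (\<Prod>n<N. refl_factor t x n) * ((1 - exp (- t * real M)) / (1 - exp (- t * real N)))"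
  using assms(5)
proof (induction M rule: dec_induct)
  case base
  show ?case using one_minus_exp_pos[of t "real N"] assms by simp
next
  case (step M)
  have "(\<Prod>n<Suc M. refl_factor t x n) = (\<Prod>n<M. refl_factor t x n) * refl_factor t x M" by simp
  also have "\<dots> \<le> ((\<Prod>n<N. refl_factor t x n) * ((1 - exp (- t * real M)) / (1 - exp (- t * real N)))) *
      ((1 - exp (- t * (real M + 1))) / (1 - exp (- t * real M)))"
    using assms step refl_factor_pos[OF assms(1-3)] one_minus_exp_pos[of t "real M"] one_minus_exp_pos[of t "real N"]
    by (intro mult_mono refl_factor_le step.IH mult_nonneg_nonneg prod_nonneg divide_nonneg_nonneg) (auto intro: less_imp_le)
  also have "\<dots> = (\<Prod>n<N. refl_factor t x n) * ((1 - exp (- t * real (Suc M))) / (1 - exp (- t * real N)))"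
    using one_minus_exp_pos[of t "real M"] assms step by (subst cancel_middle) (simp_all add: add.commute)
  finally show ?case .
qed

lemma prod_refl_factor_ge:
  assumes "t > 0" "0 < x" "x < 1" "N \<le> M"
  shows "(\<Prod>n<M. refl_factor t x n) \<ge> (\<Prod>n<N. refl_factor t x n) * ((1 - exp (- t * (real M + 1/2))) / (1 - exp (- t * (real N + 1/2))))"
  using assms(4)
proof (induction M rule: dec_induct)
  case base
  show ?case using one_minus_exp_pos[of t "real N + 1/2"] assms by simp
next
  case (step M)
  have "(\<Prod>n<N. refl_factor t x n) * ((1 - exp (- t * (real (Suc M) + 1/2))) / (1 - exp (- t * (real N + 1/2)))) =
    ((\<Prod>n<N. refl_factor t x n) * ((1 - exp (- t * (real M + 1/2))) / (1 - exp (- t * (real N + 1/2))))) *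
      ((1 - exp (- t * (real M + 3/2))) / (1 - exp (- t * (real M + 1/2))))"
    using one_minus_exp_pos[of t "real M + 1/2"] assms step by (subst cancel_middle) (simp_all add: add.commute)
  also have "\<dots> \<le> (\<Prod>n<M. refl_factor t x n) * refl_factor t x M"
    using assms step refl_factor_pos[OF assms(1-3)] one_minus_exp_pos[of t "real M + 1/2"] one_minus_exp_pos[of t "real M + 3/2"]
    by (intro mult_mono refl_factor_ge step.IH prod_nonneg divide_nonneg_nonneg) (auto intro: less_imp_le)
  also have "\<dots> = (\<Prod>n<Suc M. refl_factor t x n)" by simp
  finally show ?case .
qed

text \<open>With q = exp (- t), this times 1 - q is the product of the q-Gamma function at x and at
  1 - x; hence the growth like 1 / t as t tends to 0.\<close>

definition refl_prod :: "real \<Rightarrow> real \<Rightarrow> real" where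
  "refl_prod t x = (euler_prod t 1)\<^sup>2 / (euler_prod t x * euler_prod t (1 - x))"

lemma prod_refl_factor_LIMSEQ:
  assumes "t > 0" "0 < x" "x < 1"
  shows "(\<lambda>N. \<Prod>n<N. refl_factor t x n) \<longlonglongrightarrow> refl_prod t x"
proof -
  have "euler_prod t x * euler_prod t (1 - x) \<noteq> 0"
    using euler_prod_pos[of t x] euler_prod_pos[of t "1-x"] assms by simp
  then show ?thesis
    unfolding refl_factor_def refl_prod_def prod_dividef prod.distrib prod_power_distrib[symmetric]
    using assms by (intro tendsto_intros euler_prod_LIMSEQ) auto
qed

lemma one_minus_exp_tendsto_1:
  assumes "t > (0::real)"
  shows "(\<lambda>M. 1 - exp (- t * (real M + c))) \<longlonglongrightarrow> 1"
  using assms by real_asymp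

text \<open>Letting M tend to infinity in \<open>prod_refl_factor_le\<close> estimates the whole
  tail beyond the first N factors by one explicit quotient.\<close>

lemma refl_prod_le:
  assumes "t > 0" "0 < x" "x < 1" "N > 0"
  shows "refl_prod t x \<le> (\<Prod>n<N. refl_factor t x n) / (1 - exp (- t * real N))"
proof (rule LIMSEQ_le)
  show "(\<lambda>N. \<Prod>n<N. refl_factor t x n) \<longlonglongrightarrow> refl_prod t x"
    using prod_refl_factor_LIMSEQ assms by blast
  \<comment> \<open>The summand 0 matches the shape of
    \<open>one_minus_exp_tendsto_1\<close>.\<close>
  have "(\<lambda>M. (\<Prod>n<N. refl_factor t x n) * ((1 - exp (- t * (real M + 0))) / (1 - exp (- t * real N)))) \<longlonglongrightarrow>
    (\<Prod>n<N. refl_factor t x n) * (1 / (1 - exp (- t * real N)))"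
    using one_minus_exp_pos[of t N] assms by (intro tendsto_intros one_minus_exp_tendsto_1) auto
  then show "(\<lambda>M. (\<Prod>n<N. refl_factor t x n) * ((1 - exp (- t * real M)) / (1 - exp (- t * real N)))) \<longlonglongrightarrow>
    (\<Prod>n<N. refl_factor t x n) / (1 - exp (- t * real N))" by simp
  show "\<exists>K. \<forall>M\<ge>K. (\<Prod>n<M. refl_factor t x n) \<le> (\<Prod>n<N. refl_factor t x n) * ((1 - exp (- t * real M)) / (1 - exp (- t * real N)))"
    using prod_refl_factor_le assms by blast
qed

lemma refl_prod_ge:
  assumes "t > 0" "0 < x" "x < 1"
  shows "refl_prod t x \<ge> (\<Prod>n<N. refl_factor t x n) / (1 - exp (- t * (real N + 1/2)))"
proof (rule LIMSEQ_le)
  show "(\<lambda>N. \<Prod>n<N. refl_factor t x n) \<longlonglongrightarrow> refl_prod t x"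
    using prod_refl_factor_LIMSEQ assms by blast
  have "(\<lambda>M. (\<Prod>n<N. refl_factor t x n) * ((1 - exp (- t * (real M + 1/2))) / (1 - exp (- t * (real N + 1/2))))) \<longlonglongrightarrow>
    (\<Prod>n<N. refl_factor t x n) * (1 / (1 - exp (- t * (real N + 1/2))))"
    using one_minus_exp_pos[of t "N+1/2"] assms by (intro tendsto_intros one_minus_exp_tendsto_1) auto
  then show "(\<lambda>M. (\<Prod>n<N. refl_factor t x n) * ((1 - exp (- t * (real M + 1/2))) / (1 - exp (- t * (real N + 1/2))))) \<longlonglongrightarrow>
    (\<Prod>n<N. refl_factor t x n) / (1 - exp (- t * (real N + 1/2)))" by simp
  show "\<exists>K. \<forall>M\<ge>K. (\<Prod>n<N. refl_factor t x n) * ((1 - exp (- t * (real M + 1/2))) / (1 - exp (- t * (real N + 1/2)))) \<le> (\<Prod>n<M. refl_factor t x n)"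
    using prod_refl_factor_ge assms by blast
qed

section \<open>The limit via the product formula for the sine\<close>

definition sine_head :: "real \<Rightarrow> nat \<Rightarrow> real" where
  "sine_head x N = (\<Prod>n<N. (1 + real n)\<^sup>2 / ((x + real n) * (1 - x + real n)))"

lemma refl_factor_tendsto:
  assumes "0 < x" "x < 1"
  shows "((\<lambda>t. refl_factor t x n) \<longlongrightarrow> (1 + real n)\<^sup>2 / ((x + real n) * (1 - x + real n))) (at_right 0)"
proof -
  have *: "((\<lambda>t. (1 - exp (- t * a)) / t) \<longlongrightarrow> a) (at_right 0)" for a :: real
    by real_asymp
  have "((\<lambda>t. ((1 - exp (- t * (1 + real n))) / t)\<^sup>2 / ((1 - exp (- t * (x + real n))) / t * ((1 - exp (- t * (1 - x + real n))) / t)))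
     \<longlongrightarrow> (1 + real n)\<^sup>2 / ((x + real n) * (1 - x + real n))) (at_right 0)"
    using assms by (intro tendsto_intros *) auto
  moreover have "\<forall>\<^sub>F t in at_right 0. ((1 - exp (- t * (1 + real n))) / t)\<^sup>2 / ((1 - exp (- t * (x + real n))) / t * ((1 - exp (- t * (1 - x + real n))) / t)) = refl_factor t x n"
    using eventually_at_right_less[of "0::real"]
    by eventually_elim (simp add: refl_factor_def power2_eq_square)
  ultimately show ?thesis
    by (rule Lim_transform_eventually)
qed

text \<open>\<open>sine_head x N\<close> collects the termwise limits of the first N factors, and
  the tail bound behaves like 1 / (t c), which the factor t compensates. The lower estimate takes c
  = N + 1/2, the upper one c = N.\<close>

lemma head_tendsto:
  assumes "0 < x" "x < 1" "c > 0"
  shows "((\<lambda>t. t * ((\<Prod>n<N. refl_factor t x n) / (1 - exp (- t * c)))) \<longlongrightarrow> sine_head x N / c) (at_right 0)"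
proof -
  have *: "((\<lambda>t. t / (1 - exp (- t * c))) \<longlongrightarrow> 1 / c) (at_right 0)"
    using assms by real_asymp (simp add: field_simps)
  have "((\<lambda>t. (\<Prod>n<N. refl_factor t x n) * (t / (1 - exp (- t * c)))) \<longlongrightarrow> sine_head x N * (1 / c)) (at_right 0)"
    unfolding sine_head_def using assms by (intro tendsto_mult tendsto_prod refl_factor_tendsto *) auto
  then show ?thesis by (simp add: mult.commute)
qed

text \<open>Pairing k + x with k - x turns the denominators into factors of the sine product; x and
  1 - x + N remain unpaired.\<close>

lemma sine_head_Suc:
  assumes "0 < x" "x < 1"
  shows "sine_head x (Suc N) = (1 + real N)\<^sup>2 / (x * (1 - x + real N) * (\<Prod>k=1..N. 1 - x\<^sup>2 / real k ^ 2))"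
proof (induction N)
  case 0
  then show ?case by (simp add: sine_head_def)
next
  case (Suc N)
  have "1 - x\<^sup>2 / real (Suc N) ^ 2 = (1 - x + real N) * (x + real (Suc N)) / (1 + real N)\<^sup>2"
    by (simp add: divide_simps) (simp add: power2_eq_square algebra_simps)
  then have *: "(\<Prod>k=1..Suc N. 1 - x\<^sup>2 / real k ^ 2) = (\<Prod>k=1..N. 1 - x\<^sup>2 / real k ^ 2) * ((1 - x + real N) * (x + real (Suc N)) / (1 + real N)\<^sup>2)"
    by simp
  have alg: "A\<^sup>2 / (x * b * P) * (B / (c * d)) = B / (x * d * (P * (b * c / A\<^sup>2)))"
    if "A > 0" for A B P b c d :: real
    using that by (simp add: mult_ac)
  have "sine_head x (Suc (Suc N)) = sine_head x (Suc N) * ((1 + real (Suc N))\<^sup>2 / ((x + real (Suc N)) * (1 - x + real (Suc N))))"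
    by (simp add: sine_head_def)
  also have "\<dots> = (1 + real (Suc N))\<^sup>2 / (x * (1 - x + real (Suc N)) * (\<Prod>k=1..Suc N. 1 - x\<^sup>2 / real k ^ 2))"
    unfolding Suc.IH * by (rule alg) (use assms in auto)
  finally show ?case .
qed

text \<open>The limit is the same for every shift c, so the lower estimate (c = 1/2) and the upper
  one (c = 0) meet.\<close>

lemma sine_head_tendsto:
  assumes "0 < x" "x < 1"
  shows "(\<lambda>N. sine_head x N / (real N + c)) \<longlonglongrightarrow> pi / sin (pi * x)"
proof -
  have s: "sin (pi * x) > 0" using assms by (intro sin_gt_zero) auto
  have *: "(\<lambda>N. (1 + real N)\<^sup>2 / ((1 - x + real N) * (real (Suc N) + c))) \<longlonglongrightarrow> 1"
    by real_asymp
  have "(\<lambda>N. (1 + real N)\<^sup>2 / ((1 - x + real N) * (real (Suc N) + c)) / (x * (\<Prod>k=1..N. 1 - x\<^sup>2 / real k ^ 2))) \<longlonglongrightarrow> 1 / (x * (sin (pi * x) / (pi * x)))"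
    using assms s by (intro tendsto_intros * sin_product_formula_real') auto
  also have "(\<lambda>N. (1 + real N)\<^sup>2 / ((1 - x + real N) * (real (Suc N) + c)) / (x * (\<Prod>k=1..N. 1 - x\<^sup>2 / real k ^ 2))) =
     (\<lambda>N. sine_head x (Suc N) / (real (Suc N) + c))"
    unfolding sine_head_Suc[OF assms] by (simp only: divide_divide_eq_left mult_ac)
  also have "1 / (x * (sin (pi * x) / (pi * x))) = pi / sin (pi * x)"
    using assms by simp
  finally show ?thesis
    by (rule LIMSEQ_imp_Suc)
qed

text \<open>For each one-sided estimate, N is fixed first so that the bound already lies on the
  correct side of a; only then does t tend to 0. Thus no interchange of limits has to be
  justified.\<close>

lemma refl_prod_tendsto:
  assumes "0 < x" "x < 1"
  shows "((\<lambda>t. t * refl_prod t x) \<longlongrightarrow> pi / sin (pi * x)) (at_right 0)"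
proof (rule order_tendstoI)
  fix a assume a: "a < pi / sin (pi * x)"
  have "eventually (\<lambda>N. a < sine_head x N / (real N + 1/2)) sequentially"
    using order_tendstoD(1)[OF sine_head_tendsto[OF assms] a] .
  then obtain N where N: "a < sine_head x N / (real N + 1/2)"
    by (auto simp: eventually_sequentially)
  have "((\<lambda>t. t * ((\<Prod>n<N. refl_factor t x n) / (1 - exp (- t * (real N + 1/2))))) \<longlongrightarrow> sine_head x N / (real N + 1/2)) (at_right 0)"
    using assms by (intro head_tendsto) auto
  from order_tendstoD(1)[OF this N] eventually_at_right_less[of "0::real"]
  show "eventually (\<lambda>t. a < t * refl_prod t x) (at_right 0)"
  proof eventually_elim
    case (elim t)
    have "t * ((\<Prod>n<N. refl_factor t x n) / (1 - exp (- t * (real N + 1/2)))) \<le> t * refl_prod t x"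
      using elim assms by (intro mult_left_mono refl_prod_ge) auto
    then show ?case using elim by linarith
  qed
next
  fix a assume a: "a > pi / sin (pi * x)"
  have "eventually (\<lambda>N. a > sine_head x N / (real N + 0)) sequentially"
    using order_tendstoD(2)[OF sine_head_tendsto[OF assms] a] .
  then have "eventually (\<lambda>N. a > sine_head x N / real N \<and> N > 0) sequentially"
    using eventually_gt_at_top[of "0::nat"] by eventually_elim simp
  then obtain N where N: "a > sine_head x N / real N" "N > 0"
    by (auto simp: eventually_sequentially)
  have "((\<lambda>t. t * ((\<Prod>n<N. refl_factor t x n) / (1 - exp (- t * real N)))) \<longlongrightarrow> sine_head x N / real N) (at_right 0)"
    using assms N by (intro head_tendsto) auto
  from order_tendstoD(2)[OF this N(1)] eventually_at_right_less[of "0::real"]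
  show "eventually (\<lambda>t. a > t * refl_prod t x) (at_right 0)"
  proof eventually_elim
    case (elim t)
    have "t * refl_prod t x \<le> t * ((\<Prod>n<N. refl_factor t x n) / (1 - exp (- t * real N)))"
      using elim assms N by (intro mult_left_mono refl_prod_le) auto
    then show ?case using elim by linarith
  qed
qed

section \<open>Theta series at the cusp\<close>

text \<open>The change of variables theorems of the library require a well-ordered index type; a copy of the
  finite type, ordered through an injection into the naturals, makes them available for all of them.\<close>

typedef 'a wellordered = "UNIV :: 'a set"
  morphisms of_wellordered to_wellordered by auto

definition finite_index :: "'a :: finite \<Rightarrow> nat" where
  "finite_index = (SOME f. inj f)"

lemma inj_finite_index: "inj finite_index"
proof -
  have "\<exists>f :: 'a \<Rightarrow> nat. inj f"
    using finite_imp_inj_to_nat_seg[OF finite[of "UNIV :: 'a set"]] by blast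
  then show ?thesis
    unfolding finite_index_def by (rule someI_ex)
qed

lemma bij_to_wellordered: "bij to_wellordered"
  by (rule bij_betw_byWitness[where f' = of_wellordered])
    (auto simp: to_wellordered_inverse of_wellordered_inverse)

instance wellordered :: (finite) finite
proof
  have "range (to_wellordered :: 'a \<Rightarrow> 'a wellordered) = UNIV"
    by (rule bij_is_surj[OF bij_to_wellordered])
  then show "finite (UNIV :: 'a wellordered set)"
    using finite_imageI[OF finite[of "UNIV :: 'a set"], of to_wellordered] by simp
qed

instantiation wellordered :: (finite) wellorder
begin

definition less_eq_wellordered :: "'a wellordered \<Rightarrow> 'a wellordered \<Rightarrow> bool" where
  "x \<le> y \<longleftrightarrow> finite_index (of_wellordered x) \<le> finite_index (of_wellordered y)"

definition less_wellordered :: "'a wellordered \<Rightarrow> 'a wellordered \<Rightarrow> bool" where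
  "x < y \<longleftrightarrow> finite_index (of_wellordered x) < finite_index (of_wellordered y)"

instance
proof
  fix x y :: "'a wellordered"
  assume "x \<le> y" "y \<le> x"
  then have "finite_index (of_wellordered x) = finite_index (of_wellordered y)"
    by (simp add: less_eq_wellordered_def)
  then have "of_wellordered x = of_wellordered y"
    by (rule injD[OF inj_finite_index])
  then show "x = y"
    by (simp only: of_wellordered_inject)
next
  fix P :: "'a wellordered \<Rightarrow> bool" and a
  assume IH: "\<And>x. (\<And>y. y < x \<Longrightarrow> P y) \<Longrightarrow> P x"
  show "P a"
  proof (induction a rule: measure_induct_rule[of "\<lambda>x. finite_index (of_wellordered x)"])
    case (less x)
    show ?case
      by (rule IH, rule less) (simp only: less_wellordered_def)
  qed
qed (auto simp: less_eq_wellordered_def less_wellordered_def)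

end

section \<open>Lebesgue measure under relabelling of coordinates and invertible matrices\<close>

definition vec_of_wellordered :: "real^('n::finite) wellordered \<Rightarrow> real^'n" where
  "vec_of_wellordered x = (\<chi> i. x $ to_wellordered i)"

lemma borel_measurable_vec_lambda [measurable (raw)]:
  fixes f :: "'a \<Rightarrow> 'n::finite \<Rightarrow> real"
  assumes "\<And>i. (\<lambda>x. f x i) \<in> borel_measurable M"
  shows "(\<lambda>x. (\<chi> i. f x i)) \<in> borel_measurable M"
proof (rule borel_measurable_euclidean_space[THEN iffD2], rule ballI)
  fix b :: "real^'n" assume "b \<in> Basis"
  then obtain i where "b = axis i 1" by (auto simp: Basis_vec_def)
  then show "(\<lambda>x. (\<chi> i. f x i) \<bullet> b) \<in> borel_measurable M"
    using assms by (simp add: inner_axis)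
qed

lemma prod_Basis_vec: "(\<Prod>b\<in>(Basis :: (real^'n) set). f b) = (\<Prod>i\<in>UNIV. f (axis i 1))"
proof -
  have "(Basis :: (real^'n) set) = (\<lambda>i. axis i 1) ` UNIV"
    by (auto simp: Basis_vec_def)
  moreover have "inj (\<lambda>i::'n. axis i (1::real))"
    by (auto simp: inj_on_def axis_eq_axis)
  ultimately show ?thesis
    using prod.reindex[of "\<lambda>i::'n. axis i (1::real)" UNIV f] by (simp only: o_def)
qed

text \<open>Lebesgue measure is determined by its values on boxes, and relabelling the coordinates
  turns a box into one with the same side lengths.\<close>

lemma lborel_vec_of_wellordered: "distr lborel borel vec_of_wellordered = (lborel :: (real^'n) measure)"
proof (rule lborel_eqI[symmetric])
  fix l u :: "real^'n" assume le: "\<And>b. b \<in> Basis \<Longrightarrow> l \<bullet> b \<le> u \<bullet> b"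
  have meas: "(vec_of_wellordered :: _ \<Rightarrow> real^'n) \<in> borel_measurable borel"
    unfolding vec_of_wellordered_def[abs_def] by measurable
  define l' :: "real^'n wellordered" where "l' = (\<chi> i. l $ of_wellordered i)"
  define u' :: "real^'n wellordered" where "u' = (\<chi> i. u $ of_wellordered i)"
  have le': "l $ i \<le> u $ i" for i
    using le[of "axis i 1"] by (simp add: inner_axis)
  have eq: "vec_of_wellordered -` box l u = box l' u'"
  proof (rule set_eqI)
    fix x :: "real^'n wellordered"
    have "(\<forall>i. Q i (to_wellordered i)) \<longleftrightarrow> (\<forall>j. Q (of_wellordered j) j)" for Q :: "'n \<Rightarrow> 'n wellordered \<Rightarrow> bool"
      by (metis of_wellordered_inverse to_wellordered_inverse UNIV_I)
    from this[of "\<lambda>i j. l $ i < x $ j \<and> x $ j < u $ i"]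
    show "x \<in> vec_of_wellordered -` box l u \<longleftrightarrow> x \<in> box l' u'"
      by (simp add: mem_box_cart vec_of_wellordered_def l'_def u'_def)
  qed
  have "emeasure (distr lborel borel vec_of_wellordered) (box l u) = emeasure lborel (box l' u')"
    using meas by (simp add: emeasure_distr eq)
  also have "\<dots> = (\<Prod>b\<in>Basis. (u' - l') \<bullet> b)"
    by (intro emeasure_lborel_box) (auto simp: Basis_vec_def inner_axis l'_def u'_def le')
  also have "(\<Prod>b\<in>Basis. (u' - l') \<bullet> b) = (\<Prod>i\<in>UNIV. u $ of_wellordered i - l $ of_wellordered i)"
    by (simp add: prod_Basis_vec inner_axis l'_def u'_def)
  also have "\<dots> = (\<Prod>i\<in>UNIV. u $ i - l $ i)"
    by (rule prod.reindex_bij_witness[of _ to_wellordered of_wellordered])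
      (auto simp: of_wellordered_inverse to_wellordered_inverse)
  also have "\<dots> = (\<Prod>b\<in>Basis. (u - l) \<bullet> b)"
    by (simp add: prod_Basis_vec inner_axis)
  finally show "emeasure (distr lborel borel vec_of_wellordered) (box l u) = (\<Prod>b\<in>Basis. (u - l) \<bullet> b)" .
qed simp

text \<open>Conjugation by f matches the permutations in the two Leibniz sums and preserves
  signs.\<close>

lemma det_reindex:
  fixes A :: "real^'n^'n" and f :: "'m::finite \<Rightarrow> 'n"
  assumes f: "bij f"
  shows "det (\<chi> i j. A $ f i $ f j) = det A"
proof -
  note inv = bij_is_inj[OF f] bij_is_surj[OF f]
  have perm: "map_permutation UNIV f p permutes UNIV" if "p permutes UNIV" for p
    using map_permutation_permutes[of f UNIV UNIV p] that f by simp
  have f': "bij (inv f)" using f by (rule bij_imp_bij_inv)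
  have cancel: "inv f (f i) = i" "f (inv f j) = j" for i j
    using inv by (simp_all add: surj_f_inv_f)
  have apply_map: "map_permutation UNIV f p (f i) = f (p i)" for p i
    using map_permutation_apply[of f UNIV i p] inv by simp
  have apply_map': "map_permutation UNIV f p j = f (p (inv f j))" for p j
    using apply_map[of p "inv f j"] by (simp only: cancel)
  have apply_inv: "map_permutation UNIV (inv f) p i = inv f (p (f i))" for p i
    using map_permutation_apply[of "inv f" UNIV "f i" p] bij_is_inj[OF f'] by (simp add: cancel)
  have "det (\<chi> i j. A $ f i $ f j) = (\<Sum>p | p permutes UNIV. of_int (sign p) * (\<Prod>i\<in>UNIV. A $ f i $ f (p i)))"
    by (simp add: det_def)
  also have "\<dots> = (\<Sum>p | p permutes UNIV. of_int (sign p) * (\<Prod>i\<in>UNIV. A $ i $ p i))"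
  proof (rule sum.reindex_bij_witness[of _ "map_permutation UNIV (inv f)" "map_permutation UNIV f"])
    fix p :: "'m \<Rightarrow> 'm" assume "p \<in> {p. p permutes UNIV}"
    then have p: "p permutes UNIV" by simp
    show "map_permutation UNIV (inv f) (map_permutation UNIV f p) = p"
      by (rule ext) (simp only: apply_inv apply_map' cancel)
    show "map_permutation UNIV f p \<in> {p. p permutes UNIV}"
      using perm p by simp
    have "sign (map_permutation UNIV f p) = sign p"
      using sign_map_permutation[of f UNIV p] inv p by simp
    moreover have "(\<Prod>i\<in>UNIV. A $ i $ map_permutation UNIV f p i) = (\<Prod>i\<in>UNIV. A $ f i $ f (p i))"
      using prod.reindex_bij_betw[OF f, of "\<lambda>i. A $ i $ map_permutation UNIV f p i"]
      by (simp add: apply_map)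
    ultimately show "of_int (sign (map_permutation UNIV f p)) * (\<Prod>i\<in>UNIV. A $ i $ map_permutation UNIV f p i) =
      of_int (sign p) * (\<Prod>i\<in>UNIV. A $ f i $ f (p i))" by simp
  next
    fix p :: "'n \<Rightarrow> 'n" assume "p \<in> {p. p permutes UNIV}"
    then have p: "p permutes UNIV" by simp
    show "map_permutation UNIV f (map_permutation UNIV (inv f) p) = p"
      by (rule ext) (simp only: apply_inv apply_map' cancel)
    show "map_permutation UNIV (inv f) p \<in> {p. p permutes UNIV}"
      using map_permutation_permutes[of "inv f" UNIV UNIV p] p f' by simp
  qed
  also have "\<dots> = det A" by (simp add: det_def)
  finally show ?thesis .
qed

text \<open>Two measures are compared on boxes: the preimage of a box under \<open>B\<close> is its
  image under the inverse \<open>C\<close>, whose volume is scaled by the absolute value of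
  \<open>det C\<close>.\<close>

lemma nn_integral_matrix_wellorder:
  fixes B :: "real^'n::{finite,wellorder}^'n::_"
  assumes B: "invertible B" and f: "f \<in> borel_measurable borel"
  shows "(\<integral>\<^sup>+x. f x \<partial>lborel) = \<bar>det B\<bar> * (\<integral>\<^sup>+x. f (B *v x) \<partial>lborel)"
proof -
  obtain C where C: "C ** B = mat 1" "B ** C = mat 1"
    using B unfolding invertible_def by blast
  have meas: "(*v) B \<in> borel_measurable borel"
    by (intro borel_measurable_continuous_onI linear_continuous_on matrix_vector_mul_bounded_linear)
  have "lborel = density (distr lborel borel ((*v) B)) (\<lambda>_. ennreal \<bar>det B\<bar>)"
  proof (rule lborel_eqI)
    fix l u :: "real^'n::_" assume le: "\<And>b. b \<in> Basis \<Longrightarrow> l \<bullet> b \<le> u \<bullet> b"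
    have "(*v) B -` box l u = (*v) C ` box l u"
    proof (intro equalityI subsetI)
      fix x assume "x \<in> (*v) B -` box l u"
      then show "x \<in> (*v) C ` box l u"
        using C by (intro image_eqI[of _ _ "B *v x"]) (simp_all add: matrix_vector_mul_assoc)
    next
      fix x assume "x \<in> (*v) C ` box l u"
      then show "x \<in> (*v) B -` box l u"
        using C by (auto simp: matrix_vector_mul_assoc)
    qed
    then have lm: "(*v) B -` box l u \<in> lmeasurable"
      and meas_eq: "measure lebesgue ((*v) B -` box l u) = \<bar>det C\<bar> * measure lebesgue (box l u)"
      using measurable_linear_image[of "(*v) C" "box l u"] measure_linear_image[of "(*v) C" "box l u"]
      by simp_all
    have "(*v) B -` box l u \<in> sets borel"
      using measurable_sets[OF meas, of "box l u"] by simp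
    then have "emeasure lborel ((*v) B -` box l u) = emeasure lebesgue ((*v) B -` box l u)"
      by simp
    also have "\<dots> = ennreal (measure lebesgue ((*v) B -` box l u))"
      by (rule emeasure_eq_measure2[OF lm])
    also have "\<dots> = ennreal (\<bar>det C\<bar> * measure lborel (box l u))"
      unfolding meas_eq by simp
    finally have "emeasure lborel ((*v) B -` box l u) = ennreal (\<bar>det C\<bar> * measure lborel (box l u))" .
    moreover have "measure lborel (box l u) = (\<Prod>b\<in>Basis. (u - l) \<bullet> b)"
      using le by (simp add: measure_lborel_box_eq)
    moreover have "\<bar>det B\<bar> * \<bar>det C\<bar> = 1"
      using C by (metis abs_1 abs_mult det_I det_mul)
    ultimately have "ennreal \<bar>det B\<bar> * emeasure lborel ((*v) B -` box l u) = (\<Prod>b\<in>Basis. (u - l) \<bullet> b)"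
      by (simp add: ennreal_mult'[symmetric] mult.assoc[symmetric])
    then show "emeasure (density (distr lborel borel ((*v) B)) (\<lambda>_. ennreal \<bar>det B\<bar>)) (box l u) = (\<Prod>b\<in>Basis. (u - l) \<bullet> b)"
      using meas by (simp add: emeasure_density nn_integral_cmult_indicator emeasure_distr)
  qed simp
  then have "(\<integral>\<^sup>+x. f x \<partial>lborel) = (\<integral>\<^sup>+x. f x \<partial>(density (distr lborel borel ((*v) B)) (\<lambda>_. ennreal \<bar>det B\<bar>)))"
    by simp
  also have "\<dots> = \<bar>det B\<bar> * (\<integral>\<^sup>+x. f (B *v x) \<partial>lborel)"
    using meas f by (simp add: nn_integral_density nn_integral_distr nn_integral_cmult)
  finally show ?thesis .
qed

text \<open>Relabelling intertwines \<open>B\<close> with its copy \<open>B'\<close> over the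
  ordered index type and preserves both Lebesgue measure and the determinant, so the ordered case
  carries over.\<close>

lemma nn_integral_matrix:
  fixes B :: "real^'n^'n"
  assumes B: "invertible B" and f: "f \<in> borel_measurable borel"
  shows "(\<integral>\<^sup>+x. f x \<partial>lborel) = \<bar>det B\<bar> * (\<integral>\<^sup>+x. f (B *v x) \<partial>lborel)"
proof -
  let ?\<iota> = "vec_of_wellordered :: _ \<Rightarrow> real^'n"
  define B' :: "real^'n wellordered^'n wellordered" where "B' = (\<chi> i j. B $ of_wellordered i $ of_wellordered j)"
  have bij: "bij (of_wellordered :: 'n wellordered \<Rightarrow> 'n)"
    by (rule bij_betw_byWitness[where f' = to_wellordered])
      (auto simp: to_wellordered_inverse of_wellordered_inverse)
  have det: "det B' = det B"
    unfolding B'_def by (rule det_reindex[OF bij])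
  have meas: "?\<iota> \<in> borel_measurable borel"
    unfolding vec_of_wellordered_def[abs_def] by measurable
  have measB: "(*v) B \<in> borel_measurable borel"
    by (intro borel_measurable_continuous_onI linear_continuous_on matrix_vector_mul_bounded_linear)
  have comm: "?\<iota> (B' *v x) = B *v ?\<iota> x" for x
    unfolding vec_eq_iff
  proof
    fix i
    have "?\<iota> (B' *v x) $ i = (\<Sum>j\<in>UNIV. B $ i $ of_wellordered j * x $ j)"
      by (simp add: vec_of_wellordered_def matrix_vector_mult_def B'_def to_wellordered_inverse)
    also have "\<dots> = (\<Sum>j\<in>UNIV. B $ i $ j * x $ to_wellordered j)"
      by (rule sum.reindex_bij_witness[of _ to_wellordered of_wellordered])
        (auto simp: of_wellordered_inverse to_wellordered_inverse)
    finally show "?\<iota> (B' *v x) $ i = (B *v ?\<iota> x) $ i"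
      by (simp add: vec_of_wellordered_def matrix_vector_mult_def)
  qed
  have "(\<integral>\<^sup>+x. f x \<partial>lborel) = (\<integral>\<^sup>+x. f (?\<iota> x) \<partial>lborel)"
    using meas f by (subst lborel_vec_of_wellordered[symmetric]) (simp add: nn_integral_distr)
  also have "\<dots> = \<bar>det B'\<bar> * (\<integral>\<^sup>+x. f (?\<iota> (B' *v x)) \<partial>lborel)"
    using B det meas f by (intro nn_integral_matrix_wellorder) (simp_all add: invertible_det_nz)
  also have "\<dots> = \<bar>det B\<bar> * (\<integral>\<^sup>+x. f (B *v ?\<iota> x) \<partial>lborel)"
    by (simp add: det comm)
  also have "(\<integral>\<^sup>+x. f (B *v ?\<iota> x) \<partial>lborel) = (\<integral>\<^sup>+x. f (B *v x) \<partial>lborel)"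
    using meas f measB by (subst lborel_vec_of_wellordered[symmetric]) (simp add: nn_integral_distr)
  finally show ?thesis .
qed

section \<open>Gaussian integrals\<close>

lemma nn_integral_gaussian_real: "(\<integral>\<^sup>+x. ennreal (exp (- pi * x\<^sup>2)) \<partial>lborel) = 1"
proof -
  \<comment> \<open>With variance 1 / (2 \<pi>) the normalising factor of the normal density is 1
    and its exponent is - \<pi> x^2.\<close>
  define s where "s = sqrt (1 / (2 * pi))"
  have s: "s > 0" "s\<^sup>2 = 1 / (2 * pi)" by (simp_all add: s_def)
  interpret prob_space "density lborel (normal_density 0 s)"
    using prob_space_normal_density s by blast
  have "normal_density 0 s x = exp (- pi * x\<^sup>2)" for x
    by (simp add: normal_density_def s field_simps)
  then show ?thesis
    using emeasure_space_1 by (simp add: emeasure_density)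
qed

lemma nn_integral_gaussian: "(\<integral>\<^sup>+x. ennreal (exp (- pi * (x \<bullet> x))) \<partial>(lborel :: 'a::euclidean_space measure)) = 1"
proof -
  have "exp (- pi * (x \<bullet> x)) = (\<Prod>b\<in>Basis. exp (- pi * (x \<bullet> b)\<^sup>2))" for x :: 'a
    by (subst euclidean_inner) (simp add: exp_sum[symmetric] sum_distrib_left sum_negf power2_eq_square)
  then have "(\<integral>\<^sup>+x. ennreal (exp (- pi * (x \<bullet> x))) \<partial>(lborel :: 'a measure)) =
     (\<integral>\<^sup>+x. (\<Prod>b\<in>Basis. ennreal (exp (- pi * (x \<bullet> b)\<^sup>2))) \<partial>(lborel :: 'a measure))"
    by (simp add: prod_ennreal)
  also have "\<dots> = 1"
    by (subst nn_integral_lborel_prod) (simp_all add: nn_integral_gaussian_real[simplified])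
  finally show ?thesis .
qed

text \<open>The value is the reciprocal covolume of the lattice spanned by the columns of
  \<open>B\<close>; this is how the volume enters the quantum dimension.\<close>

lemma has_bochner_integral_gaussian_matrix:
  fixes B :: "real^'n^'n"
  assumes B: "invertible B"
  shows "has_bochner_integral lborel (\<lambda>x. exp (- pi * ((B *v x) \<bullet> (B *v x)))) (1 / \<bar>det B\<bar>)"
proof (rule has_bochner_integral_nn_integral)
  have [measurable]: "(*v) B \<in> borel_measurable borel"
    by (intro borel_measurable_continuous_onI linear_continuous_on matrix_vector_mul_bounded_linear)
  show "(\<lambda>x. exp (- pi * ((B *v x) \<bullet> (B *v x)))) \<in> borel_measurable lborel"
    by measurable
  have d: "\<bar>det B\<bar> > 0" using B by (simp add: invertible_det_nz)
  have "1 = ennreal \<bar>det B\<bar> * (\<integral>\<^sup>+x. ennreal (exp (- pi * ((B *v x) \<bullet> (B *v x)))) \<partial>lborel)"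
    using nn_integral_matrix[OF B, of "\<lambda>x. ennreal (exp (- pi * (x \<bullet> x)))"] nn_integral_gaussian[where 'a = "real^'n"]
    by simp
  then have "ennreal (1 / \<bar>det B\<bar>) * 1 = ennreal (1 / \<bar>det B\<bar>) * (ennreal \<bar>det B\<bar> * (\<integral>\<^sup>+x. ennreal (exp (- pi * ((B *v x) \<bullet> (B *v x)))) \<partial>lborel))"
    by simp
  also have "\<dots> = (\<integral>\<^sup>+x. ennreal (exp (- pi * ((B *v x) \<bullet> (B *v x)))) \<partial>lborel)"
    using d by (simp add: mult.assoc[symmetric] ennreal_mult'[symmetric])
  finally show "(\<integral>\<^sup>+x. ennreal (exp (- pi * ((B *v x) \<bullet> (B *v x)))) \<partial>lborel) = ennreal (1 / \<bar>det B\<bar>)"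
    by simp
qed auto

section \<open>Sums over integer vectors as integrals of step functions\<close>

definition vec_floor :: "real^'n \<Rightarrow> int^'n" where
  "vec_floor x = (\<chi> i. \<lfloor>x $ i\<rfloor>)"

definition vec_of_int :: "int^'n \<Rightarrow> real^'n" where
  "vec_of_int z = (\<chi> i. real_of_int (z $ i))"

text \<open>The fibres of \<open>vec_floor\<close> are half-open unit cubes, so each integer vector
  receives mass 1.\<close>

lemma distr_vec_floor:
  "vec_floor \<in> borel \<rightarrow>\<^sub>M count_space (UNIV :: (int^'n) set)"
  "distr lborel (count_space UNIV) vec_floor = count_space (UNIV :: (int^'n) set)"
proof -
  have vimage: "vec_floor -` {z} = (\<Inter>i. {x. \<lfloor>x $ i\<rfloor> = z $ i})" for z :: "int^'n"
    by (auto simp: vec_floor_def vec_eq_iff)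
  have borel: "vec_floor -` {z} \<in> sets borel" for z :: "int^'n"
    unfolding vimage by measurable
  show meas: "vec_floor \<in> borel \<rightarrow>\<^sub>M count_space (UNIV :: (int^'n) set)"
    using borel by (auto simp: measurable_count_space_eq_countable)
  have one: "emeasure lborel (vec_floor -` {z}) = 1" for z :: "int^'n"
  proof (rule antisym)
    have le: "vec_of_int z \<bullet> b \<le> (vec_of_int z + (\<chi> i. 1)) \<bullet> b" if "b \<in> Basis" for b
      using that by (auto simp: Basis_vec_def inner_axis)
    have vol: "(\<Prod>b\<in>Basis. ((vec_of_int z + (\<chi> i. 1)) - vec_of_int z) \<bullet> b) = 1"
      by (simp add: prod_Basis_vec inner_axis)
    \<comment> \<open>The half-open cube is squeezed between the open and the closed cube, both of
      volume 1.\<close>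
    have "vec_floor -` {z} \<subseteq> cbox (vec_of_int z) (vec_of_int z + (\<chi> i. 1))"
      by (auto simp: mem_box_cart vimage vec_of_int_def floor_eq_iff)
         (metis floor_correct less_imp_le)+
    then have "emeasure lborel (vec_floor -` {z}) \<le> emeasure lborel (cbox (vec_of_int z) (vec_of_int z + (\<chi> i. 1)))"
      by (intro emeasure_mono) auto
    then show "emeasure lborel (vec_floor -` {z}) \<le> 1"
      using le vol by (simp add: emeasure_lborel_cbox)
    have "box (vec_of_int z) (vec_of_int z + (\<chi> i. 1)) \<subseteq> vec_floor -` {z}"
      by (auto simp: mem_box_cart vimage vec_of_int_def floor_eq_iff less_imp_le)
    then have "emeasure lborel (box (vec_of_int z) (vec_of_int z + (\<chi> i. 1))) \<le> emeasure lborel (vec_floor -` {z})"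
      using borel by (intro emeasure_mono) auto
    then show "1 \<le> emeasure lborel (vec_floor -` {z})"
      using le vol by (simp add: emeasure_lborel_box)
  qed
  show "distr lborel (count_space UNIV) vec_floor = count_space (UNIV :: (int^'n) set)"
    by (rule measure_eqI_countable[of _ UNIV]) (use meas one in \<open>auto simp: emeasure_distr\<close>)
qed

text \<open>Since \<open>vec_floor\<close> pushes Lebesgue measure to counting measure,
  integrability of the step function amounts to absolute summability of \<open>h\<close>.\<close>

lemma infsum_eq_integral_floor:
  fixes h :: "int^'n \<Rightarrow> real"
  assumes "integrable lborel (\<lambda>x. h (vec_floor x))"
  shows "infsum h UNIV = (\<integral>x. h (vec_floor x) \<partial>lborel)"
proof -
  have sum: "Infinite_Set_Sum.abs_summable_on h UNIV"
  proof -
    have "integrable (distr lborel (count_space UNIV) vec_floor) h"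
      using assms distr_vec_floor(1) by (subst integrable_distr_eq) auto
    then show ?thesis
      unfolding Infinite_Set_Sum.abs_summable_on_def by (simp only: distr_vec_floor(2))
  qed
  have "infsum h UNIV = (\<integral>z. h z \<partial>count_space UNIV)"
    by (simp add: infsetsum_infsum[OF sum, symmetric] infsetsum_def)
  also have "\<dots> = (\<integral>x. h (vec_floor x) \<partial>lborel)"
    by (subst distr_vec_floor(2)[symmetric], subst integral_distr) (use distr_vec_floor(1) in auto)
  finally show ?thesis .
qed

lemma has_bochner_integral_scaleR:
  fixes f :: "real^'n \<Rightarrow> real"
  assumes "s > 0" "f \<in> borel_measurable borel"
  shows "has_bochner_integral lborel f (s ^ CARD('n) * I) \<longleftrightarrow> has_bochner_integral lborel (\<lambda>x. f (s *\<^sub>R x)) I"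
proof -
  have eq: "lborel = density (distr lborel borel (\<lambda>x::real^'n. s *\<^sub>R x)) (\<lambda>_. s ^ CARD('n))"
    using lborel_affine[of s "0 :: real^'n"] assms by simp
  have "has_bochner_integral lborel f (s ^ CARD('n) * I) \<longleftrightarrow>
     has_bochner_integral (density (distr lborel borel (\<lambda>x::real^'n. s *\<^sub>R x)) (\<lambda>_. ennreal (s ^ CARD('n)))) f (s ^ CARD('n) * I)"
    using eq by simp
  also have "\<dots> \<longleftrightarrow> has_bochner_integral (distr lborel borel (\<lambda>x::real^'n. s *\<^sub>R x)) (\<lambda>x. s ^ CARD('n) *\<^sub>R f x) (s ^ CARD('n) * I)"
    using assms by (auto simp: has_bochner_integral_iff integrable_density integral_density)
  also have "\<dots> \<longleftrightarrow> has_bochner_integral lborel (\<lambda>x. f (s *\<^sub>R x)) I"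
    using assms by (auto simp: has_bochner_integral_iff integrable_distr_eq integral_distr)
  finally show ?thesis .
qed

text \<open>The step function is now constant on cubes of side s, whose volume is the factor in
  front of the sum: a Riemann sum of mesh s.\<close>

lemma infsum_eq_integral_scaled_floor:
  fixes h :: "int^'n \<Rightarrow> real"
  assumes s: "s > 0" and int: "integrable lborel (\<lambda>x. h (vec_floor ((1 / s) *\<^sub>R x)))"
  shows "s ^ CARD('n) * infsum h UNIV = (\<integral>x. h (vec_floor ((1 / s) *\<^sub>R x)) \<partial>lborel)"
proof -
  have [measurable]: "(\<lambda>x. h (vec_floor ((1 / s) *\<^sub>R x))) \<in> borel_measurable borel"
    using int by (simp add: borel_measurable_integrable)
  define I where "I = (\<integral>x. h (vec_floor ((1 / s) *\<^sub>R x)) \<partial>lborel)"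
  have "has_bochner_integral lborel (\<lambda>x. h (vec_floor ((1 / s) *\<^sub>R x))) (s ^ CARD('n) * (I / s ^ CARD('n)))"
    using s int by (simp add: I_def has_bochner_integral_iff)
  then have "has_bochner_integral lborel (\<lambda>x. h (vec_floor x)) (I / s ^ CARD('n))"
    using s by (subst (asm) has_bochner_integral_scaleR) auto
  then have "infsum h UNIV = I / s ^ CARD('n)"
    using infsum_eq_integral_floor[of h] by (simp add: has_bochner_integral_iff)
  then show ?thesis using s by (simp add: I_def)
qed

lemma infsum_lattice_of:
  fixes B :: "real^'n^'n"
  assumes "invertible B"
  shows "infsum f (lattice_of B) = infsum (\<lambda>z. f (B *v vec_of_int z)) UNIV"
proof -
  have "lattice_of B = (\<lambda>z. B *v vec_of_int z) ` UNIV"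
  proof (intro equalityI subsetI)
    fix x assume "x \<in> lattice_of B"
    then obtain z where z: "x = B *v z" "\<forall>i. z $ i \<in> \<int>" by (auto simp: lattice_of_def)
    have "real_of_int \<lfloor>z $ i\<rfloor> = z $ i" for i
      using z(2)[rule_format, of i] by (elim Ints_cases) simp
    then have eq: "vec_of_int (vec_floor z) = z"
      by (simp add: vec_of_int_def vec_floor_def vec_eq_iff)
    show "x \<in> (\<lambda>z. B *v vec_of_int z) ` UNIV"
      by (rule image_eqI[of _ _ "vec_floor z"]) (simp_all add: eq z)
  qed (auto simp: lattice_of_def vec_of_int_def)
  moreover have "inj (\<lambda>z. B *v vec_of_int z)"
  proof (rule injI)
    fix z z' :: "int^'n"
    assume "B *v vec_of_int z = B *v vec_of_int z'"
    then have "vec_of_int z = vec_of_int z'"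
      by (rule injD[OF inj_matrix_vector_mult[OF assms]])
    then show "z = z'"
      by (simp add: vec_of_int_def vec_eq_iff)
  qed
  ultimately show ?thesis
    by (simp add: infsum_reindex o_def)
qed

text \<open>The scaled theta series is the integral of a Gaussian whose argument is rounded to a
  grid of mesh sqrt y; dominated convergence removes the rounding as y tends to 0.\<close>

lemma theta_tendsto:
  fixes B :: "real^'n^'n"
  assumes B: "invertible B"
  shows "((\<lambda>y. sqrt y ^ CARD('n) * theta_L (lattice_of B) y) \<longlongrightarrow> 1 / \<bar>det B\<bar>) (at_right 0)"
proof (rule tendsto_at_right_sequentially[of 0 1])
  \<comment> \<open>Dominated convergence works along sequences; values below 1 keep the mesh below
    1, so that one dominating function serves all n.\<close>
  fix Y :: "nat \<Rightarrow> real"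
  assume Y: "\<And>n. 0 < Y n" "\<And>n. Y n < 1" "Y \<longlonglongrightarrow> 0"
  define s where "s n = sqrt (Y n)" for n
  have s: "s n > 0" "s n < 1" "s n ^ 2 = Y n" for n
    using Y(1,2)[of n] less_imp_le[OF Y(1)[of n]] by (auto simp: s_def)
  have s_lim: "s \<longlonglongrightarrow> 0"
    using tendsto_real_sqrt[OF Y(3)] by (simp add: s_def[abs_def])
  \<comment> \<open>\<open>r n x\<close> is the lower corner of the grid cell of side
    \<open>s n\<close> that contains x.\<close>
  define r where "r n x = s n *\<^sub>R vec_of_int (vec_floor ((1 / s n) *\<^sub>R x))" for n and x :: "real^'n"
  define g where "g v = exp (- pi * ((B *v v) \<bullet> (B *v v)))" for v
  have r_close: "\<bar>r n x $ i - x $ i\<bar> \<le> s n" for n x i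
  proof -
    have "\<bar>real_of_int \<lfloor>x $ i / s n\<rfloor> - x $ i / s n\<bar> \<le> 1"
      using floor_correct[of "x $ i / s n"] by linarith
    then have "s n * \<bar>real_of_int \<lfloor>x $ i / s n\<rfloor> - x $ i / s n\<bar> \<le> s n * 1"
      using s(1)[of n] by (intro mult_left_mono) auto
    also have "s n * \<bar>real_of_int \<lfloor>x $ i / s n\<rfloor> - x $ i / s n\<bar> = \<bar>s n * (real_of_int \<lfloor>x $ i / s n\<rfloor> - x $ i / s n)\<bar>"
      using s(1)[of n] by (simp add: abs_mult)
    also have "\<dots> = \<bar>r n x $ i - x $ i\<bar>"
      using s(1)[of n] by (simp add: r_def vec_of_int_def vec_floor_def algebra_simps)
    finally show ?thesis by simp
  qed
  have [measurable]: "(*v) B \<in> borel_measurable borel"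
    by (intro borel_measurable_continuous_onI linear_continuous_on matrix_vector_mul_bounded_linear)
  have [measurable]: "r n \<in> borel_measurable borel" for n
    unfolding r_def[abs_def] vec_of_int_def vec_floor_def vec_lambda_beta vector_scaleR_component by measurable
  have [measurable]: "g \<in> borel_measurable borel"
    unfolding g_def[abs_def] by measurable
  \<comment> \<open>The left inverse bounds the norm of \<open>B *v v\<close> from below by norm v /
    K, which provides the decay of the dominating function.\<close>
  obtain C where C: "C ** B = mat 1"
    using B unfolding invertible_def by blast
  obtain K where K: "K > 0" "\<And>v. norm (C *v v) \<le> norm v * K"
    using bounded_linear.pos_bounded[OF matrix_vector_mul_bounded_linear[of C]] by blast
  have below: "norm (B *v v) \<ge> norm v / K" for v
    using K(2)[of "B *v v"] K(1) C by (simp add: matrix_vector_mul_assoc field_simps)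
  define N where "N = real CARD('n)"
  have dist_r: "norm (r n x - x) \<le> N" for n x
  proof -
    have "norm (r n x - x) \<le> (\<Sum>i\<in>UNIV. \<bar>(r n x - x) $ i\<bar>)"
      by (rule norm_le_l1_cart)
    also have "\<dots> \<le> (\<Sum>i\<in>(UNIV::'n set). 1)"
      using r_close s(2) by (intro sum_mono) (metis less_imp_le order_trans vector_minus_component)
    finally show ?thesis by (simp add: N_def)
  qed
  \<comment> \<open>Since norm x is at most norm (r n x) + N, the value (norm x)^2 / (2 K^2) is at
    most (norm (B *v r n x))^2 + (N / K)^2; this dictates \<open>a\<close> and the constant in
    \<open>w\<close>. Writing the scaling as a matrix makes the Gaussian integral above
    applicable.\<close>
  define a where "a = 1 / (sqrt 2 * K)"
  define w where "w x = exp (pi * (N / K)\<^sup>2) * exp (- pi * ((matrix ((*\<^sub>R) a) *v x) \<bullet> (matrix ((*\<^sub>R) a) *v x)))" for x :: "real^'n"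
  have a: "a > 0" using K by (simp add: a_def)
  have int_w: "integrable lborel w"
  proof -
    have "invertible (matrix ((*\<^sub>R) a) :: real^'n^'n)"
      using a by (simp add: invertible_det_nz)
    then show ?thesis unfolding w_def
      by (intro integrable_mult_right has_bochner_integral_gaussian_matrix[THEN integrable.intros])
  qed
  have bound: "norm (g (r n x)) \<le> w x" for n x
  proof -
    have "norm x \<le> norm (r n x) + N"
      using dist_r[of n x] norm_triangle_ineq2[of x "r n x"] by (simp add: norm_minus_commute)
    then have "(norm x)\<^sup>2 \<le> (norm (r n x) + N)\<^sup>2"
      by (intro power_mono) auto
    also have "\<dots> \<le> 2 * (norm (r n x))\<^sup>2 + 2 * N\<^sup>2"
      using sum_squares_bound[of "norm (r n x)" N] by (simp add: power2_sum)
    finally have "(norm x)\<^sup>2 / (2 * K\<^sup>2) \<le> (2 * (norm (r n x))\<^sup>2 + 2 * N\<^sup>2) / (2 * K\<^sup>2)"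
      by (intro divide_right_mono) auto
    also have "\<dots> = (norm (r n x) / K)\<^sup>2 + (N / K)\<^sup>2"
      by (simp add: power_divide add_divide_distrib)
    also have "(norm (r n x) / K)\<^sup>2 \<le> (norm (B *v r n x))\<^sup>2"
      using below K by (intro power_mono) auto
    finally have "pi * ((norm x)\<^sup>2 / (2 * K\<^sup>2)) \<le> pi * ((norm (B *v r n x))\<^sup>2 + (N / K)\<^sup>2)"
      by (intro mult_left_mono) auto
    moreover have "matrix ((*\<^sub>R) a) *v x = a *\<^sub>R x"
      by (simp add: matrix_works)
    ultimately show ?thesis
      by (simp add: g_def w_def exp_add[symmetric] a_def power2_norm_eq_inner[symmetric] power_mult_distrib power_divide algebra_simps)
  qed
  have int_r: "integrable lborel (\<lambda>x. g (r n x))" for n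
    by (rule Bochner_Integration.integrable_bound[OF int_w]) (use bound in \<open>auto intro: order_trans[OF _ abs_ge_self]\<close>)
  have r_lim: "(\<lambda>n. r n x) \<longlonglongrightarrow> x" for x
  proof (rule vec_tendstoI)
    fix i
    have "(\<lambda>n. r n x $ i - x $ i) \<longlonglongrightarrow> 0"
      by (rule tendsto_rabs_zero_cancel, rule tendsto_sandwich[OF _ _ tendsto_const s_lim]) (use r_close in auto)
    then show "(\<lambda>n. r n x $ i) \<longlonglongrightarrow> x $ i"
      by (simp add: LIM_zero_iff)
  qed
  have "(\<lambda>n. \<integral>x. g (r n x) \<partial>lborel) \<longlonglongrightarrow> (\<integral>x. g x \<partial>lborel)"
  proof (rule integral_dominated_convergence[OF _ _ int_w])
    have "isCont g x" for x
      unfolding g_def[abs_def]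
      by (intro continuous_intros linear_continuous_at matrix_vector_mul_bounded_linear)
    then show "AE x in lborel. (\<lambda>n. g (r n x)) \<longlonglongrightarrow> g x"
      using r_lim isCont_tendsto_compose by blast
  qed (use bound in auto)
  also have "(\<integral>x. g x \<partial>lborel) = 1 / \<bar>det B\<bar>"
    using has_bochner_integral_gaussian_matrix[OF B] by (simp add: g_def has_bochner_integral_iff)
  also have "(\<lambda>n. \<integral>x. g (r n x) \<partial>lborel) = (\<lambda>n. sqrt (Y n) ^ CARD('n) * theta_L (lattice_of B) (Y n))"
  proof
    fix n
    \<comment> \<open>As y is the square of the mesh, the theta term of \<open>B *v z\<close> is the
      Gaussian at the grid point s z.\<close>
    have "theta_L (lattice_of B) (Y n) = infsum (\<lambda>z. g (s n *\<^sub>R vec_of_int z)) UNIV"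
      unfolding theta_L_def infsum_lattice_of[OF B]
      by (intro infsum_cong) (simp add: qpow_def g_def matrix_vector_mult_scaleR s(3)[symmetric] power2_eq_square algebra_simps)
    then show "(\<integral>x. g (r n x) \<partial>lborel) = sqrt (Y n) ^ CARD('n) * theta_L (lattice_of B) (Y n)"
      using infsum_eq_integral_scaled_floor[OF s(1)[of n], of "\<lambda>z. g (s n *\<^sub>R vec_of_int z)"] int_r[of n]
      by (simp add: r_def s_def)
  qed
  finally show "(\<lambda>n. sqrt (Y n) ^ CARD('n) * theta_L (lattice_of B) (Y n)) \<longlonglongrightarrow> 1 / \<bar>det B\<bar>" .
qed simp

section \<open>Fixed-point-free isometries of finite order\<close>

text \<open>The sign of the exponent is that in the definition of \<open>h^(i;\<sigma>)\<close>.\<close>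

definition unity_root :: "nat \<Rightarrow> nat \<Rightarrow> complex" where
  "unity_root p k = cis (- 2 * pi * real k / real p)"

section \<open>Arithmetic of the roots of unity\<close>

lemma unity_root_eq_cnj: "unity_root p k = cnj (cis (2 * pi * real k / real p))"
  by (simp add: unity_root_def cis_cnj)

lemma inj_on_unity_root:
  assumes "p > 0"
  shows "inj_on (unity_root p) {..<p}"
proof -
  have "inj_on (\<lambda>k. cis (2 * pi * real k / real p)) {..<p}"
    using Complex.bij_betw_roots_unity[OF assms] by (rule bij_betw_imp_inj_on)
  then show ?thesis
    unfolding inj_on_def unity_root_eq_cnj complex_cnj_cancel_iff .
qed

lemma unity_root_0 [simp]: "unity_root p 0 = 1"
  by (simp add: unity_root_def)

lemma unity_root_add: "unity_root p (a + b) = unity_root p a * unity_root p b"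
proof -
  have "- 2 * pi * real (a + b) / real p = - 2 * pi * real a / real p + - 2 * pi * real b / real p"
    by (simp only: of_nat_add distrib_left add_divide_distrib)
  then show ?thesis by (simp only: unity_root_def cis_mult)
qed

lemma unity_root_power: "unity_root p k ^ m = unity_root p (k * m)"
  by (induction m) (simp_all add: unity_root_add)

lemma unity_root_eq_1_iff:
  assumes "k < p"
  shows "unity_root p k = 1 \<longleftrightarrow> k = 0"
proof
  assume "unity_root p k = 1"
  then have eq: "unity_root p k = unity_root p 0" by simp
  have "inj_on (unity_root p) {..<p}"
    using assms by (intro inj_on_unity_root) simp
  then show "k = 0"
    by (rule inj_onD) (use assms eq in auto)
qed simp

lemma unity_root_mult_self:
  assumes "p > 0"
  shows "unity_root p (k * p) = 1"
proof -
  have "- 2 * pi * real p / real p = - (2 * pi)" using assms by simp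
  then have "unity_root p p = 1"
    unfolding unity_root_def by (simp add: complex_eq_iff)
  then show ?thesis
    using unity_root_power[of p p k] by (simp add: mult.commute)
qed

lemma sum_unity_root:
  assumes "j < p"
  shows "(\<Sum>k<p. unity_root p (k * j)) = (if j = 0 then of_nat p else 0)"
proof (cases "j = 0")
  case False
  have "(\<Sum>k<p. unity_root p (k * j)) = (\<Sum>k<p. unity_root p j ^ k)"
    by (simp add: unity_root_power mult.commute)
  also have "\<dots> = (unity_root p j ^ p - 1) / (unity_root p j - 1)"
    using False assms by (intro geometric_sum) (simp add: unity_root_eq_1_iff)
  also have "\<dots> = 0"
    using assms by (simp add: unity_root_power unity_root_mult_self)
  finally show ?thesis using False by simp
qed simp

lemma norm_one_minus_unity_root:
  assumes "k \<le> p" "p > 0"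
  shows "cmod (1 - unity_root p k) = 2 * sin (pi * (real k / real p))"
proof -
  define x where "x = pi * (real k / real p)"
  have x: "0 \<le> x" "x \<le> pi" using assms mult_left_le[of "real k / real p" pi] by (simp_all add: x_def)
  have "- 2 * pi * real k / real p = - (2 * x)"
    by (simp add: x_def)
  then have ur: "unity_root p k = cis (- (2 * x))"
    by (simp only: unity_root_def)
  have "(cmod (1 - unity_root p k))\<^sup>2 = (1 - cos (2 * x))\<^sup>2 + (sin (2 * x))\<^sup>2"
    unfolding ur by (simp add: cmod_power2)
  also have "\<dots> = 2 - 2 * cos (2 * x)"
    using sin_cos_squared_add[of "2 * x"] by (simp add: power2_diff)
  also have "\<dots> = (2 * sin x)\<^sup>2"
    by (simp add: cos_double_sin power_mult_distrib)
  finally show ?thesis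
    using x sin_ge_zero[of x] unfolding x_def[symmetric]
    by (elim power2_eq_imp_eq) simp_all
qed

section \<open>Diagonalization of a matrix of finite order\<close>

lemma matrix_vector_mult_scale: "A *v (c *s u) = c *s (A *v u)" for A :: "'a::comm_semiring_1^'n^'m"
  by (simp add: vec_eq_iff matrix_vector_mult_def sum_distrib_left mult_ac)

lemma matrix_vector_mult_sum: "A *v (\<Sum>i\<in>I. u i) = (\<Sum>i\<in>I. A *v u i)" for A :: "'a::comm_semiring_1^'n^'m"
  by (induction I rule: infinite_finite_induct) (simp_all add: matrix_vector_right_distrib)

text \<open>Up to the factor \<open>1/p\<close>, \<open>P k\<close> is the projection onto an eigenspace; the exponent \<open>k (p - 1) j\<close>
  stands for \<open>- k j\<close>, which is not available on the naturals.\<close>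

lemma eigenvector_average:
  fixes A :: "complex^'n^'n"
  assumes p: "p > 0" and fin: "((*v) A ^^ p) = id"
  defines "P \<equiv> \<lambda>k u. \<Sum>j<p. unity_root p (k * (p - 1) * j) *s (((*v) A ^^ j) u)"
  shows "A *v P k u = unity_root p k *s P k u"
proof -
  let ?f = "\<lambda>j. unity_root p (k * (p - 1) * j) *s (((*v) A ^^ j) u)"
  have shift: "unity_root p k * unity_root p (k * (p - 1) * Suc j) = unity_root p (k * (p - 1) * j)" for j
  proof -
    have "k + k * (p - 1) * Suc j = k * (p - 1) * j + k * p"
      using p by (cases p) (auto simp: algebra_simps)
    then have "unity_root p k * unity_root p (k * (p - 1) * Suc j) = unity_root p (k * (p - 1) * j) * unity_root p (k * p)"
      by (simp only: unity_root_add[symmetric])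
    then show ?thesis by (simp add: unity_root_mult_self p)
  qed
  have "A *v P k u = (\<Sum>j<p. unity_root p (k * (p - 1) * j) *s (((*v) A ^^ Suc j) u))"
    by (simp add: P_def matrix_vector_mult_sum matrix_vector_mult_scale)
  also have "\<dots> = (\<Sum>j<p. unity_root p k *s ?f (Suc j))"
    by (intro sum.cong refl) (simp only: vec.scale_scale shift)
  also have "\<dots> = unity_root p k *s (\<Sum>j<p. ?f (Suc j))"
    by (simp only: vec.scale_sum_right)
  \<comment> \<open>The shift by one is cyclic: the terms at j = 0 and j = p both equal u.\<close>
  also have "(\<Sum>j<p. ?f (Suc j)) + ?f 0 = (\<Sum>j<p. ?f j) + ?f p"
    using sum.lessThan_Suc_shift[of ?f p] by (simp add: add.commute)
  then have "(\<Sum>j<p. ?f (Suc j)) = (\<Sum>j<p. ?f j)"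
    using fin by (simp add: unity_root_mult_self p)
  finally show ?thesis by (simp add: P_def)
qed

text \<open>Orthogonality of the roots of unity: summation over k cancels every iterate except j =
  0.\<close>

lemma eigenvector_average_sum:
  fixes A :: "complex^'n^'n"
  assumes p: "p > 0"
  defines "P \<equiv> \<lambda>k u. \<Sum>j<p. unity_root p (k * (p - 1) * j) *s (((*v) A ^^ j) u)"
  shows "(\<Sum>k<p. P k u) = of_nat p *s u"
proof -
  have s: "(\<Sum>k<p. unity_root p (k * (p - 1) * j)) = (if j = 0 then of_nat p else 0)" if "j < p" for j
  proof (cases "j = 0")
    case False
    \<comment> \<open>Both exponents are congruent to - k j modulo p.\<close>
    have "unity_root p (k * (p - 1) * j) = unity_root p (k * (p - j))" for k
    proof -
      have "k * (p - 1) * j + k * p = k * (p - j) + k * j * p"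
      proof -
        have "(p - 1) * j + p = (p - j) + j * p"
          using p that by (cases p) (auto simp: algebra_simps)
        then have "k * ((p - 1) * j + p) = k * ((p - j) + j * p)" by simp
        then show ?thesis by (simp only: distrib_left mult.assoc)
      qed
      then have "unity_root p (k * (p - 1) * j) * unity_root p (k * p) = unity_root p (k * (p - j)) * unity_root p (k * j * p)"
        by (simp only: unity_root_add[symmetric])
      then show ?thesis by (simp add: unity_root_mult_self p)
    qed
    then show ?thesis
      using sum_unity_root[of "p - j" p] False that by simp
  qed simp
  have "(\<Sum>k<p. P k u) = (\<Sum>j<p. \<Sum>k<p. unity_root p (k * (p - 1) * j) *s (((*v) A ^^ j) u))"
    unfolding P_def by (rule sum.swap)
  also have "\<dots> = (\<Sum>j<p. (\<Sum>k<p. unity_root p (k * (p - 1) * j)) *s (((*v) A ^^ j) u))"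
    by (simp only: vec.scale_sum_left)
  also have "\<dots> = (\<Sum>j<p. (if j = 0 then of_nat p else 0) *s (((*v) A ^^ j) u))"
    by (intro sum.cong refl) (simp only: s lessThan_iff)
  also have "\<dots> = (\<Sum>j<p. if j = 0 then of_nat p *s u else 0)"
    by (intro sum.cong) auto
  also have "\<dots> = of_nat p *s u"
    using p by (simp add: sum.delta)
  finally show ?thesis .
qed

text \<open>Every vector is 1/p times the sum of its averages, which lie in eigenspaces; so the
  eigenvectors span, and a basis chosen among them supplies the columns of \<open>Q\<close>.\<close>

lemma finite_order_diagonalizable:
  fixes A :: "complex^'n^'n"
  assumes p: "p > 0" and fin: "((*v) A ^^ p) = id"
  obtains Q :: "complex^'n^'n" and \<kappa> where "invertible Q" "\<And>j. \<kappa> j < p"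
    "A ** Q = Q ** (\<chi> i j. if i = j then unity_root p (\<kappa> j) else 0)"
proof -
  define E where "E = {u. \<exists>k<p. A *v u = unity_root p k *s u}"
  have "u \<in> vec.span E" for u
  proof -
    define P where "P k = (\<Sum>j<p. unity_root p (k * (p - 1) * j) *s (((*v) A ^^ j) u))" for k
    have "P k \<in> E" if "k < p" for k
      unfolding E_def P_def using eigenvector_average[OF p fin, of k u] that by blast
    then have "(\<Sum>k<p. P k) \<in> vec.span E"
      by (intro vec.span_sum vec.span_base) auto
    then have "(1 / of_nat p) *s (\<Sum>k<p. P k) \<in> vec.span E"
      by (rule vec.span_scale)
    also have "(1 / of_nat p) *s (\<Sum>k<p. P k) = u"
      unfolding P_def eigenvector_average_sum[OF p] using p by (simp add: vec.scale_scale)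
    finally show ?thesis .
  qed
  then have spanE: "vec.span E = UNIV" by auto
  obtain S where S: "S \<subseteq> E" "vec.independent S" "E \<subseteq> vec.span S"
    using vec.maximal_independent_subset[of E] by blast
  have spanS: "vec.span S = UNIV"
    using vec.span_mono[OF S(3)] spanE by (simp add: vec.span_span top.extremum_uniqueI)
  have "card S = vec.dim (UNIV :: (complex^'n) set)"
    using S spanS by (intro vec.basis_card_eq_dim) auto
  then have "card S = CARD('n)"
    by (simp only: vec_dim_card)
  then obtain f :: "'n \<Rightarrow> complex^'n" where f: "bij_betw f UNIV S"
    using finite_same_card_bij[of "UNIV :: 'n set" S] vec.finiteI_independent[OF S(2)] by auto
  have "\<exists>k<p. A *v f j = unity_root p k *s f j" for j
    using f S(1) by (auto simp: E_def bij_betw_def)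
  then obtain \<kappa> where \<kappa>: "\<And>j. \<kappa> j < p" "\<And>j. A *v f j = unity_root p (\<kappa> j) *s f j"
    by metis
  define Q where "Q = (\<chi> i j. f j $ i)"
  have col: "column j Q = f j" for j
    by (simp add: column_def Q_def vec_eq_iff)
  have "columns Q = S"
    using f by (auto simp: columns_def col bij_betw_def)
  then have "invertible Q"
    using spanS by (simp add: invertible_right_inverse matrix_right_invertible_span_columns)
  moreover have "A ** Q = Q ** (\<chi> i j. if i = j then unity_root p (\<kappa> j) else 0)"
  proof -
    have "(A ** Q) $ i $ j = (A *v f j) $ i" for i j
      by (simp add: matrix_matrix_mult_def matrix_vector_mult_def Q_def)
    moreover have "(Q ** (\<chi> i j. if i = j then unity_root p (\<kappa> j) else 0)) $ i $ j = (unity_root p (\<kappa> j) *s f j) $ i" for i j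
      by (simp add: matrix_matrix_mult_def Q_def if_distrib cong: if_cong)
    ultimately show ?thesis
      by (simp add: vec_eq_iff \<kappa>(2))
  qed
  ultimately show ?thesis using that \<kappa>(1) by blast
qed

text \<open>\<open>Q\<close> carries the coordinate subspace of the indices with D j = c
  isomorphically onto the eigenspace.\<close>

lemma dim_eigenspace_diagonalized:
  fixes A Q :: "'a::field^'n^'n"
  assumes Q: "invertible Q" and AQ: "A ** Q = Q ** (\<chi> i j. if i = j then D j else 0)"
  shows "vec.dim {u. A *v u = c *s u} = card {j. D j = c}"
proof -
  let ?W = "{w :: 'a^'n. \<forall>j. j \<notin> {j. D j = c} \<longrightarrow> w $ j = 0}"
  obtain R where R: "Q ** R = mat 1"
    using Q unfolding invertible_def by blast
  have inj: "inj ((*v) Q)" by (rule inj_matrix_vector_mult[OF Q])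
  have diag: "((\<chi> i j. if i = j then D j else 0) *v w) $ j = D j * w $ j" for w j
    by (simp add: matrix_vector_mult_def if_distrib[of "\<lambda>x. x * _"] cong: if_cong)
  have key: "A *v (Q *v w) = c *s (Q *v w) \<longleftrightarrow> w \<in> ?W" for w
  proof -
    have "A *v (Q *v w) = c *s (Q *v w) \<longleftrightarrow> Q *v ((\<chi> i j. if i = j then D j else 0) *v w) = Q *v (c *s w)"
      by (simp add: matrix_vector_mul_assoc AQ matrix_vector_mult_scale)
    also have "\<dots> \<longleftrightarrow> (\<chi> i j. if i = j then D j else 0) *v w = c *s w"
      by (rule inj_eq[OF inj])
    also have "\<dots> \<longleftrightarrow> w \<in> ?W"
      by (auto simp: vec_eq_iff diag)
    finally show ?thesis .
  qed
  have QR: "Q *v (R *v u) = u" for u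
    by (simp add: matrix_vector_mul_assoc R)
  have "{u. A *v u = c *s u} = (*v) Q ` ?W"
  proof (intro equalityI subsetI)
    fix u assume "u \<in> {u. A *v u = c *s u}"
    then have "A *v (Q *v (R *v u)) = c *s (Q *v (R *v u))"
      by (simp only: QR mem_Collect_eq)
    then have "R *v u \<in> ?W"
      by (rule key[THEN iffD1])
    then show "u \<in> (*v) Q ` ?W"
      by (rule image_eqI[rotated]) (simp only: QR)
  qed (use key in blast)
  then have "vec.dim {u. A *v u = c *s u} = vec.dim ((*v) Q ` ?W)" by (simp only:)
  also have "\<dots> = vec.dim ?W"
    by (rule vec.dim_image_eq) (simp_all add: inj_on_subset[OF inj])
  finally have "vec.dim {u. A *v u = c *s u} = vec.dim ?W" .
  then show ?thesis by (simp only: dim_substandard_cart)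
qed

lemma matrix_add_rdistrib: "(A + B) ** C = A ** C + B ** C"
  by (simp add: vec_eq_iff matrix_matrix_mult_def distrib_right sum.distrib)

lemma det_one_minus_diagonalized:
  fixes A Q :: "'a::field^'n^'n"
  assumes Q: "invertible Q" and AQ: "A ** Q = Q ** (\<chi> i j. if i = j then D j else 0)"
  shows "det (mat 1 - A) = (\<Prod>j\<in>UNIV. 1 - D j)"
proof -
  let ?D = "(\<chi> i j. if i = j then D j else 0) :: 'a^'n^'n"
  \<comment> \<open>The two products are compared after adding \<open>Q ** ?D\<close> to each, so
    that only distributivity over sums enters.\<close>
  have 1: "(mat 1 - A) ** Q + Q ** ?D = Q"
    unfolding AQ[symmetric] matrix_add_rdistrib[symmetric] by simp
  have 2: "Q ** (mat 1 - ?D) + Q ** ?D = Q"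
    unfolding matrix_add_ldistrib[symmetric] by simp
  have "(mat 1 - A) ** Q = Q ** (mat 1 - ?D)"
    by (rule add_right_imp_eq[OF trans[OF 1 2[symmetric]]])
  from arg_cong[OF this, of det] have "det (mat 1 - A) * det Q = det Q * det (mat 1 - ?D)"
    by (simp only: det_mul)
  moreover have "det Q \<noteq> 0" using Q by (simp add: invertible_det_nz)
  moreover have "det (mat 1 - ?D) = (\<Prod>j\<in>UNIV. 1 - D j)"
    by (subst det_diagonal) (auto simp: mat_def)
  ultimately show ?thesis by simp
qed

section \<open>Complex conjugation and the symmetry of the eigenspace dimensions\<close>

definition cvec_cnj :: "complex^'n \<Rightarrow> complex^'n" where
  "cvec_cnj u = (\<chi> i. cnj (u $ i))"

text \<open>Conjugation is semilinear, so the conjugates of a basis of V span the conjugates of V.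
  Equality will follow because conjugation is an involution.\<close>

lemma dim_cvec_cnj_le:
  fixes V :: "(complex^'n) set"
  shows "vec.dim (cvec_cnj ` V) \<le> vec.dim V"
proof -
  obtain S where S: "S \<subseteq> V" "vec.independent S" "V \<subseteq> vec.span S" "card S = vec.dim V"
    using vec.basis_exists[of V] by blast
  have "cvec_cnj u \<in> vec.span (cvec_cnj ` S)" if "u \<in> vec.span S" for u
    using that
  proof (induction rule: vec.span_induct_alt)
    case base
    have "cvec_cnj 0 = (0 :: complex^'n)" by (simp add: cvec_cnj_def vec_eq_iff)
    then show ?case by (simp only: vec.span_zero)
  next
    case (step c x y)
    have "cvec_cnj (c *s x + y) = cnj c *s cvec_cnj x + cvec_cnj y"
      by (simp add: cvec_cnj_def vec_eq_iff)
    then show ?case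
      using step by (simp add: vec.span_add vec.span_scale vec.span_base)
  qed
  then have "cvec_cnj ` V \<subseteq> vec.span (cvec_cnj ` S)" using S(3) by auto
  then have "vec.dim (cvec_cnj ` V) \<le> card (cvec_cnj ` S)"
    using vec.finiteI_independent[OF S(2)] by (intro vec.dim_le_card) auto
  also have "\<dots> \<le> card S"
    using vec.finiteI_independent[OF S(2)] by (rule card_image_le)
  finally show ?thesis using S(4) by simp
qed

definition cmatrix :: "real^'n^'m \<Rightarrow> complex^'n^'m" where
  "cmatrix M = (\<chi> a b. complex_of_real (M $ a $ b))"

text \<open>A real matrix commutes with conjugation, which therefore exchanges the eigenspaces of c
  and \<open>cnj c\<close>.\<close>

lemma dim_eigenspace_cnj:
  fixes M :: "real^'n^'n"
  shows "vec.dim {u. cmatrix M *v u = cnj c *s u} = vec.dim {u. cmatrix M *v u = c *s u}"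
proof -
  have cnj_mult: "cmatrix M *v cvec_cnj u = cvec_cnj (cmatrix M *v u)" for u
    by (simp add: vec_eq_iff cmatrix_def cvec_cnj_def matrix_vector_mult_def)
  have scale: "cvec_cnj (c *s u) = cnj c *s cvec_cnj u" for c and u :: "complex^'n"
    by (simp add: vec_eq_iff cvec_cnj_def)
  have idem: "cvec_cnj (cvec_cnj u) = u" for u :: "complex^'n"
    by (simp add: vec_eq_iff cvec_cnj_def)
  have img: "cvec_cnj ` {u. cmatrix M *v u = c *s u} = {u. cmatrix M *v u = cnj c *s u}" for c
  proof (intro equalityI subsetI)
    fix u assume "u \<in> {u. cmatrix M *v u = cnj c *s u}"
    then have "cmatrix M *v cvec_cnj u = c *s cvec_cnj u"
      by (simp add: cnj_mult scale)
    then show "u \<in> cvec_cnj ` {u. cmatrix M *v u = c *s u}"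
      by (intro image_eqI[of _ _ "cvec_cnj u"]) (simp_all add: idem)
  qed (auto simp: cnj_mult scale)
  have le: "vec.dim {u. cmatrix M *v u = cnj c *s u} \<le> vec.dim {u. cmatrix M *v u = c *s u}" for c
    unfolding img[symmetric] by (rule dim_cvec_cnj_le)
  show ?thesis
    using le[of c] le[of "cnj c"] by simp
qed

lemma r_dim_eq: "r_dim \<sigma> p i = vec.dim {u. cmatrix (matrix \<sigma>) *v u = unity_root p i *s u}"
  by (simp add: r_dim_def cmatrix_def unity_root_def)

text \<open>The roots with indices i and p - i are conjugate. This symmetry allows x = i/p to be
  paired with 1 - x.\<close>

lemma r_dim_symmetric:
  assumes "i \<le> p" "p > 0"
  shows "r_dim \<sigma> p (p - i) = r_dim \<sigma> p i"
proof -
  have "2 * pi * real (p - i) / real p = 2 * pi - 2 * pi * real i / real p"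
    using assms by (simp add: of_nat_diff field_simps)
  then have "unity_root p (p - i) = cnj (unity_root p i)"
    by (simp add: unity_root_eq_cnj complex_eq_iff cos_diff sin_diff)
  then show ?thesis
    by (simp add: r_dim_eq dim_eigenspace_cnj)
qed

section \<open>Complexification and the spectrum\<close>

definition cvec_Re :: "complex^'n \<Rightarrow> real^'n" where
  "cvec_Re u = (\<chi> i. Re (u $ i))"

definition cvec_Im :: "complex^'n \<Rightarrow> real^'n" where
  "cvec_Im u = (\<chi> i. Im (u $ i))"

lemma cvec_eq_iff: "u = v \<longleftrightarrow> cvec_Re u = cvec_Re v \<and> cvec_Im u = cvec_Im v"
  by (auto simp: vec_eq_iff cvec_Re_def cvec_Im_def complex_eq_iff)

lemma cvec_sum:
  "cvec_Re (\<Sum>i\<in>I. f i) = (\<Sum>i\<in>I. cvec_Re (f i))" "cvec_Im (\<Sum>i\<in>I. f i) = (\<Sum>i\<in>I. cvec_Im (f i))"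
  by (simp_all add: vec_eq_iff cvec_Re_def cvec_Im_def)

text \<open>The complexified map acts separately on real and imaginary parts, so identities between
  iterates of \<sigma> transfer to it.\<close>

lemma cmatrix_iterate:
  fixes \<sigma> :: "real^'n \<Rightarrow> real^'n"
  assumes "linear \<sigma>"
  shows "cvec_Re (((*v) (cmatrix (matrix \<sigma>)) ^^ k) u) = (\<sigma> ^^ k) (cvec_Re u)"
    "cvec_Im (((*v) (cmatrix (matrix \<sigma>)) ^^ k) u) = (\<sigma> ^^ k) (cvec_Im u)"
proof -
  have "cvec_Re (cmatrix (matrix \<sigma>) *v u) = \<sigma> (cvec_Re u)" "cvec_Im (cmatrix (matrix \<sigma>) *v u) = \<sigma> (cvec_Im u)" for u
  proof -
    have "cvec_Re (cmatrix M *v u) = M *v cvec_Re u" "cvec_Im (cmatrix M *v u) = M *v cvec_Im u" for M :: "real^'n^'n"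
      by (simp_all add: vec_eq_iff cvec_Re_def cvec_Im_def cmatrix_def matrix_vector_mult_def)
    then show "cvec_Re (cmatrix (matrix \<sigma>) *v u) = \<sigma> (cvec_Re u)" "cvec_Im (cmatrix (matrix \<sigma>) *v u) = \<sigma> (cvec_Im u)"
      using assms by (simp_all add: matrix_works)
  qed
  then show "cvec_Re (((*v) (cmatrix (matrix \<sigma>)) ^^ k) u) = (\<sigma> ^^ k) (cvec_Re u)"
    "cvec_Im (((*v) (cmatrix (matrix \<sigma>)) ^^ k) u) = (\<sigma> ^^ k) (cvec_Im u)"
    by (induction k) simp_all
qed

lemma det_cmatrix: "det (cmatrix M) = complex_of_real (det M)"
  by (simp add: det_def cmatrix_def)

text \<open>After diagonalization r_i counts the indices with eigenvalue exponent i, and vanishing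
  orbit sums exclude the eigenvalue 1. Grouping the indices by exponent gives the rank and, from the
  factors 1 - \<xi>^i, the determinant.\<close>

lemma fixed_point_free_spectrum:
  fixes \<sigma> :: "real^'n \<Rightarrow> real^'n"
  assumes p: "p > 0" and lin: "linear \<sigma>" and fin: "\<sigma> ^^ p = id"
    and avg: "\<And>v. (\<Sum>k<p. (\<sigma> ^^ k) v) = 0"
  shows "(\<Sum>i=1..p-1. r_dim \<sigma> p i) = CARD('n)"
    "\<bar>det (mat 1 - matrix \<sigma>)\<bar> = (\<Prod>i=1..p-1. (2 * sin (pi * (real i / real p))) ^ r_dim \<sigma> p i)"
proof -
  let ?A = "cmatrix (matrix \<sigma>)"
  have "((*v) ?A ^^ p) u = u" for u
    unfolding cvec_eq_iff cmatrix_iterate[OF lin] fin by simp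
  then have finA: "((*v) ?A ^^ p) = id" unfolding fun_eq_iff id_apply by (rule allI)
  obtain Q :: "complex^'n^'n" and \<kappa> where Q: "invertible Q" "\<And>j. \<kappa> j < p"
    "?A ** Q = Q ** (\<chi> i j. if i = j then unity_root p (\<kappa> j) else 0)"
    by (rule finite_order_diagonalizable[OF p finA]) blast
  have r: "r_dim \<sigma> p i = card {j. \<kappa> j = i}" if "i < p" for i
  proof -
    have "{j. unity_root p (\<kappa> j) = unity_root p i} = {j. \<kappa> j = i}"
      by (rule Collect_cong, rule inj_on_eq_iff[OF inj_on_unity_root[OF p]]) (simp_all add: Q(2) that)
    then show ?thesis
      by (simp add: r_dim_eq dim_eigenspace_diagonalized[OF Q(1,3)])
  qed
  \<comment> \<open>The orbit sum of a fixed vector is p times that vector.\<close>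
  have "u = 0" if u: "?A *v u = u" for u
  proof -
    have it: "((*v) ?A ^^ k) u = u" for k
      by (induction k) (simp_all add: u)
    have "(\<Sum>k<p. ((*v) ?A ^^ k) u) = 0"
      unfolding cvec_eq_iff cvec_sum cmatrix_iterate[OF lin] avg
      by (simp add: cvec_Re_def cvec_Im_def vec_eq_iff)
    then have "(\<Sum>k<p. u) = 0" by (simp only: it)
    then have "(\<Sum>k<p. u $ i) = 0" for i
      by (simp only: sum_component[symmetric] zero_index)
    then show ?thesis using p by (simp add: vec_eq_iff)
  qed
  then have "{u. ?A *v u = unity_root p 0 *s u} = {0}"
    by (auto simp: matrix_vector_mult_0_right)
  then have "r_dim \<sigma> p 0 = 0"
    by (simp add: r_dim_eq)
  then have no_zero: "{j. \<kappa> j = 0} = {}"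
    using r[OF p] by simp
  have \<kappa>: "\<kappa> j \<in> {1..p-1}" for j
  proof -
    have "\<kappa> j \<noteq> 0" using no_zero by simp
    then show ?thesis using Q(2)[of j] by (simp add: Suc_le_eq)
  qed
  have "(\<Sum>i=1..p-1. r_dim \<sigma> p i) = (\<Sum>i=1..p-1. \<Sum>j | j \<in> UNIV \<and> \<kappa> j = i. 1)"
    using r by (intro sum.cong) auto
  also have "\<dots> = (\<Sum>j\<in>(UNIV :: 'n set). 1)"
    by (rule sum.group[OF finite finite_atLeastAtMost]) (use \<kappa> in blast)
  finally show "(\<Sum>i=1..p-1. r_dim \<sigma> p i) = CARD('n)" by simp
  have "cmatrix (mat 1 - matrix \<sigma>) = mat 1 - ?A"
    by (simp add: vec_eq_iff cmatrix_def mat_def)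
  then have "complex_of_real (det (mat 1 - matrix \<sigma>)) = (\<Prod>j\<in>UNIV. 1 - unity_root p (\<kappa> j))"
    using det_one_minus_diagonalized[OF Q(1,3)] by (simp only: det_cmatrix[symmetric])
  from arg_cong[OF this, of cmod] have "\<bar>det (mat 1 - matrix \<sigma>)\<bar> = (\<Prod>j\<in>UNIV. cmod (1 - unity_root p (\<kappa> j)))"
    by (simp only: norm_of_real prod_norm[symmetric])
  also have "\<dots> = (\<Prod>i=1..p-1. \<Prod>j | j \<in> UNIV \<and> \<kappa> j = i. cmod (1 - unity_root p (\<kappa> j)))"
    by (rule prod.group[OF finite finite_atLeastAtMost, symmetric]) (use \<kappa> in blast)
  also have "\<dots> = (\<Prod>i=1..p-1. (2 * sin (pi * (real i / real p))) ^ r_dim \<sigma> p i)"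
  proof (intro prod.cong refl)
    fix i assume i: "i \<in> {1..p-1}"
    then have "(\<Prod>j | j \<in> UNIV \<and> \<kappa> j = i. cmod (1 - unity_root p (\<kappa> j))) = cmod (1 - unity_root p i) ^ card {j. \<kappa> j = i}"
      by simp
    also have "\<dots> = (2 * sin (pi * (real i / real p))) ^ r_dim \<sigma> p i"
    proof -
      have "i < p" using i p by auto
      then show ?thesis
        using r[of i] norm_one_minus_unity_root[of i p] p by simp
    qed
    finally show "(\<Prod>j | j \<in> UNIV \<and> \<kappa> j = i. cmod (1 - unity_root p (\<kappa> j))) = (2 * sin (pi * (real i / real p))) ^ r_dim \<sigma> p i" .
  qed
  finally show "\<bar>det (mat 1 - matrix \<sigma>)\<bar> = (\<Prod>i=1..p-1. (2 * sin (pi * (real i / real p))) ^ r_dim \<sigma> p i)" .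
qed

text \<open>The sum of the images of a lattice vector under the powers of \<open>\<sigma>\<close> is a lattice vector fixed by \<open>\<sigma>\<close>.\<close>

lemma orbit_sum_eq_0:
  fixes \<sigma> :: "real^'n \<Rightarrow> real^'n"
  assumes lin: "linear \<sigma>" and fin: "\<sigma> ^^ p = id"
    and img: "\<sigma> ` lattice_of B \<subseteq> lattice_of B" and B: "invertible B"
    and fpf: "\<And>a. a \<in> lattice_of B \<Longrightarrow> \<sigma> a = a \<Longrightarrow> a = 0"
  shows "(\<Sum>k<p. (\<sigma> ^^ k) v) = 0"
proof -
  define N where "N v = (\<Sum>k<p. (\<sigma> ^^ k) v)" for v
  have lin_pow: "linear (\<sigma> ^^ k)" for k
  proof (induction k)
    case (Suc k)
    then show ?case using linear_compose[OF Suc lin] by (simp only: funpow.simps)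
  qed (simp add: linear_id[unfolded id_def] id_def)
  have lin_N: "linear N"
    unfolding N_def[abs_def] by (intro linear_compose_sum ballI lin_pow)
  have add: "a + b \<in> lattice_of B" if ab: "a \<in> lattice_of B" "b \<in> lattice_of B" for a b
  proof -
    from ab obtain z w where "a = B *v z" "b = B *v w" "\<forall>i. z $ i \<in> \<int>" "\<forall>i. w $ i \<in> \<int>"
      unfolding lattice_of_def by blast
    then have "a + b = B *v (z + w)" "\<forall>i. (z + w) $ i \<in> \<int>"
      by (simp_all add: matrix_vector_right_distrib)
    then show ?thesis unfolding lattice_of_def by blast
  qed
  have zero: "0 \<in> lattice_of B"
    unfolding lattice_of_def by (rule CollectI, rule exI[of _ 0]) simp
  have pow: "(\<sigma> ^^ k) a \<in> lattice_of B" if "a \<in> lattice_of B" for a k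
    using that img by (induction k) auto
  have N_in: "N a \<in> lattice_of B" if "a \<in> lattice_of B" for a
  proof -
    have "(\<Sum>k<m. (\<sigma> ^^ k) a) \<in> lattice_of B" for m
      by (induction m) (simp_all add: zero add pow that)
    then show ?thesis by (simp add: N_def)
  qed
  have "\<sigma> (N a) = N a" for a
  proof -
    have "\<sigma> (N a) = (\<Sum>k<p. (\<sigma> ^^ Suc k) a)"
      by (simp add: N_def linear_sum[OF lin])
    moreover have "(\<Sum>k<p. (\<sigma> ^^ Suc k) a) + a = (\<Sum>k<p. (\<sigma> ^^ k) a) + (\<sigma> ^^ p) a"
      using sum.lessThan_Suc_shift[of "\<lambda>k. (\<sigma> ^^ k) a" p] by (simp add: add.commute)
    ultimately show ?thesis using fin by (simp add: N_def)
  qed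
  then have N_lattice: "N a = 0" if "a \<in> lattice_of B" for a
    using fpf N_in that by blast
  \<comment> \<open>The images under \<open>B\<close> of the standard basis vectors are lattice
    vectors and span the space, so a linear map vanishing on the lattice is 0.\<close>
  have NB: "(\<lambda>x. N (B *v x)) = (\<lambda>x. 0)"
  proof (rule linear_eq_stdbasis)
    show "linear (\<lambda>x. N (B *v x))"
      using linear_compose[OF matrix_vector_mul_linear lin_N] by (simp add: o_def)
    show "linear (\<lambda>x. 0 :: real^'n)" by (rule linear_zero)
    fix b :: "real^'n" assume "b \<in> Basis"
    then have "\<forall>i. b $ i \<in> \<int>" by (auto simp: Basis_vec_def axis_def)
    then have "B *v b \<in> lattice_of B" unfolding lattice_of_def by blast
    then show "N (B *v b) = 0" by (rule N_lattice)
  qed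
  obtain C where "B ** C = mat 1" using B unfolding invertible_def by blast
  then have "B *v (C *v v) = v" by (simp add: matrix_vector_mul_assoc)
  then have "N v = 0"
    using fun_cong[OF NB, of "C *v v"] by (simp only:)
  then show ?thesis by (simp add: N_def)
qed

text \<open>Each x^d - 1 is x - 1 times the geometric sum \<open>G x d\<close>, which equals d at x
  = 1. Since det (1 - M) is nonzero, the powers of x - 1 on the two sides agree; cancelling them and
  letting x tend to 1 gives the value.\<close>

lemma char_poly_at_1:
  fixes M :: "real^'n^'n" and m :: "nat \<Rightarrow> int"
  assumes p: "p > 0" and nz: "det (mat 1 - M) \<noteq> 0"
    and char: "\<forall>x::real. det (x *\<^sub>R mat 1 - M)
            * (\<Prod>d\<in>{d. d dvd p \<and> m d < 0}. (x ^ d - 1) ^ nat (- m d))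
          = (\<Prod>d\<in>{d. d dvd p \<and> m d > 0}. (x ^ d - 1) ^ nat (m d))"
  shows "det (mat 1 - M) = (\<Prod>d\<in>{d. d dvd p}. real d powi m d)"
proof -
  let ?N = "{d. d dvd p \<and> m d < 0}" and ?P = "{d. d dvd p \<and> m d > 0}"
  have fin: "finite {d. d dvd p}" using p by simp
  have finN: "finite ?N" and finP: "finite ?P"
    by (auto intro: finite_subset[OF _ fin])
  define G where "G x d = (\<Sum>i<d. x ^ i)" for x :: real and d :: nat
  define a where "a = (\<Sum>d\<in>?N. nat (- m d))"
  define b where "b = (\<Sum>d\<in>?P. nat (m d))"
  define f where "f x = det (x *\<^sub>R mat 1 - M) * (\<Prod>d\<in>?N. G x d ^ nat (- m d))" for x
  define g where "g x = (\<Prod>d\<in>?P. G x d ^ nat (m d))" for x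
  have G1: "G 1 d = real d" for d by (simp add: G_def)
  have eq: "f x * (x - 1) ^ a = g x * (x - 1) ^ b" for x
    using char[rule_format, of x]
    by (simp add: f_def g_def a_def b_def G_def power_diff_1_eq power_mult_distrib prod.distrib power_sum mult_ac)
  have cont_G: "isCont (\<lambda>x. G x d) x" for x d
    unfolding G_def by (intro continuous_intros)
  have "isCont f x" for x
    unfolding f_def det_def by (intro continuous_intros cont_G)
  then have f_lim: "f \<midarrow>1\<rightarrow> f 1" by (simp add: isCont_def)
  have "isCont g x" for x
    unfolding g_def by (intro continuous_intros cont_G)
  then have g_lim: "g \<midarrow>1\<rightarrow> g 1" by (simp add: isCont_def)
  have dpos: "real d > 0" if "d dvd p" for d
    using that p by (auto intro: Nat.gr0I)
  have f1: "f 1 = det (mat 1 - M) * (\<Prod>d\<in>?N. real d ^ nat (- m d))"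
    by (simp add: f_def G1)
  have g1: "g 1 = (\<Prod>d\<in>?P. real d ^ nat (m d))"
    by (simp add: g_def G1)
  have prodN: "(\<Prod>d\<in>?N. real d ^ nat (- m d)) > 0" and prodP: "(\<Prod>d\<in>?P. real d ^ nat (m d)) > 0"
    using dpos by (auto intro!: prod_pos)
  \<comment> \<open>If the powers of x - 1 differed, the side with the smaller power would have a
    remaining factor vanishing at 1. Cancellation is possible only for x \<noteq> 1, hence the
    limit.\<close>
  have vanish: "u 1 = 0"
    if h: "u \<midarrow>1\<rightarrow> u 1" "w \<midarrow>1\<rightarrow> w 1" and k: "j < k" "\<And>x. u x * (x - 1) ^ j = w x * (x - 1) ^ k"
    for u w :: "real \<Rightarrow> real" and j k
  proof -
    have "((\<lambda>x. w x * (x - 1) ^ (k - j)) \<longlongrightarrow> w 1 * (1 - 1) ^ (k - j)) (at 1)"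
      by (intro tendsto_intros h)
    moreover have "w 1 * (1 - 1) ^ (k - j) = 0"
      using k(1) by (simp add: power_0_left)
    ultimately have "((\<lambda>x. w x * (x - 1) ^ (k - j)) \<longlongrightarrow> 0) (at 1)"
      by (simp only:)
    moreover have "\<forall>\<^sub>F x in at 1. w x * (x - 1) ^ (k - j) = u x"
    proof (rule eventually_at_filter[THEN iffD2], intro always_eventually allI impI)
      fix x :: real assume "x \<noteq> 1"
      moreover have "(x - 1) ^ k = (x - 1) ^ (k - j) * (x - 1) ^ j"
        using k(1) by (simp add: power_add[symmetric])
      ultimately show "w x * (x - 1) ^ (k - j) = u x"
        using k(2)[of x] by simp
    qed
    ultimately have "(u \<longlongrightarrow> 0) (at 1)" by (rule Lim_transform_eventually)
    then show ?thesis using h(1) by (rule LIM_unique[symmetric])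
  qed
  have "f 1 \<noteq> 0" "g 1 \<noteq> 0"
    using f1 g1 nz prodN prodP by simp_all
  then have "\<not> a < b" "\<not> b < a"
    using vanish[OF f_lim g_lim _ eq] vanish[OF g_lim f_lim _ eq[symmetric]] by blast+
  then have "a = b" by simp
  have "\<forall>\<^sub>F x in at 1. f x = g x"
    using eq \<open>a = b\<close> unfolding eventually_at_filter by (intro always_eventually allI) auto
  then have "g \<midarrow>1\<rightarrow> f 1" by (rule Lim_transform_eventually[OF f_lim])
  then have "f 1 = g 1" using g_lim by (rule LIM_unique)
  have "(\<Prod>d\<in>{d. d dvd p}. real d powi m d) * (\<Prod>d\<in>?N. real d ^ nat (- m d)) = (\<Prod>d\<in>?P. real d ^ nat (m d))"
  proof -
    have "(\<Prod>d\<in>?N. real d ^ nat (- m d)) = (\<Prod>d\<in>{d. d dvd p}. if m d < 0 then real d ^ nat (- m d) else 1)"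
      using fin by (simp add: prod.If_cases Collect_conj_eq Int_commute)
    moreover have "(\<Prod>d\<in>?P. real d ^ nat (m d)) = (\<Prod>d\<in>{d. d dvd p}. if m d > 0 then real d ^ nat (m d) else 1)"
      using fin by (simp add: prod.If_cases Collect_conj_eq Int_commute)
    moreover have "real d powi m d * (if m d < 0 then real d ^ nat (- m d) else 1) = (if m d > 0 then real d ^ nat (m d) else 1)" if "d dvd p" for d
      using dpos[OF that] by (auto simp: power_int_def field_simps)
    ultimately show ?thesis
      by (simp add: prod.distrib[symmetric])
  qed
  also have "\<dots> = det (mat 1 - M) * (\<Prod>d\<in>?N. real d ^ nat (- m d))"
    using \<open>f 1 = g 1\<close> by (simp only: f1 g1)
  finally show ?thesis
    by (rule mult_right_cancel[OF less_imp_neq[OF prodN, symmetric], THEN iffD1, symmetric])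
qed

section \<open>The quantum dimension\<close>

lemma eta_eq: "dedekind_eta y = qpow y (1/24) * euler_prod (2 * pi * y) 1"
  by (simp add: dedekind_eta_def euler_prod_def qpow_def add.commute mult_ac)

text \<open>The symmetry of the eigenspace dimensions replaces r_{p-i} by r_i, and convergence
  allows the exponent to be taken out of the infinite product.\<close>

lemma Z_M1_eq:
  fixes \<sigma> :: "real^'n \<Rightarrow> real^'n"
  assumes y: "y > 0" and p: "p > 0"
  shows "Z_M1 \<sigma> p y = qpow y (rho \<sigma> p - real CARD('n) / 24) /
     (\<Prod>i = 1..p-1. euler_prod (2 * pi * y) (real i / real p) ^ r_dim \<sigma> p i)"
proof -
  have "prodinf (\<lambda>n. (1 - qpow y (real i / real p + real n)) ^ r_dim \<sigma> p (p - i)) =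
    euler_prod (2 * pi * y) (real i / real p) ^ r_dim \<sigma> p i" if i: "i \<in> {1..p-1}" for i
  proof -
    have "convergent_prod (\<lambda>n. 1 - exp (- (2 * pi * y) * (real i / real p + real n)))"
      using i y p by (intro convergent_euler_prod) auto
    from prodinf_power[OF this, of "r_dim \<sigma> p i"]
    have "prodinf (\<lambda>n. (1 - qpow y (real i / real p + real n)) ^ r_dim \<sigma> p i) =
      euler_prod (2 * pi * y) (real i / real p) ^ r_dim \<sigma> p i"
      by (simp add: euler_prod_def qpow_def)
    moreover have "r_dim \<sigma> p (p - i) = r_dim \<sigma> p i"
      using i p by (intro r_dim_symmetric) auto
    ultimately show ?thesis by simp
  qed
  then show ?thesis
    unfolding Z_M1_def by (intro arg_cong2[of _ _ _ _ "(/)"] prod.cong refl)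
qed

theorem mainTheorem4:
  fixes B :: "real^'n^'n" and L :: "(real^'n) set" and \<sigma> :: "real^'n \<Rightarrow> real^'n"
    and p :: nat and dimT :: nat and m :: "nat \<Rightarrow> int"
  assumes "invertible B" and "L = lattice_of B" and "even_lattice L"
    and "p \<ge> 2"
    and "linear \<sigma>" and "\<sigma> ` L = L" and "\<forall>a\<in>L. \<forall>b\<in>L. \<sigma> a \<bullet> \<sigma> b = a \<bullet> b"
    and "\<sigma> ^^ p = id" and "\<forall>k. 0 < k \<and> k < p \<longrightarrow> \<sigma> ^^ k \<noteq> id"
    and "\<forall>a\<in>L. \<sigma> a = a \<longrightarrow> a = 0"
    and "\<forall>x::real. det (x *\<^sub>R mat 1 - matrix \<sigma>)
            * (\<Prod>d\<in>{d. d dvd p \<and> m d < 0}. (x ^ d - 1) ^ nat (- m d))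
          = (\<Prod>d\<in>{d. d dvd p \<and> m d > 0}. (x ^ d - 1) ^ nat (m d))"
  shows "qdim_is (Z_VLT \<sigma> p dimT) (Z_VL L)
           (\<bar>det B\<bar> * real dimT / sqrt (\<Prod>d\<in>{d. d dvd p}. real d powi m d))"
proof -
  have p: "p > 0" using assms(4) by simp
  let ?l = "CARD('n)" and ?I = "{1..p-1}"
  let ?r = "r_dim \<sigma> p" and ?D = "\<bar>det (mat 1 - matrix \<sigma>)\<bar>"
  have avg: "(\<Sum>k<p. (\<sigma> ^^ k) v) = 0" for v
    by (rule orbit_sum_eq_0[OF assms(5,8) _ assms(1)]) (use assms(2,6,10) in auto)
  note sum_r = fixed_point_free_spectrum(1)[OF p assms(5,8) avg]
  note det_r = fixed_point_free_spectrum(2)[OF p assms(5,8) avg]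
  have i_range: "0 < real i / real p" "real i / real p < 1" "i < p" "1 - real i / real p = real (p - i) / real p" if "i \<in> ?I" for i
    using that p by (auto simp: field_simps of_nat_diff)
  have sin_pos: "sin (pi * (real i / real p)) > 0" if "i \<in> ?I" for i
  proof (rule sin_gt_zero)
    show "0 < pi * (real i / real p)"
      using i_range(1)[OF that] by (intro mult_pos_pos pi_gt_zero)
    show "pi * (real i / real p) < pi"
      using mult_strict_left_mono[OF i_range(2)[OF that] pi_gt_zero] by simp
  qed
  have D_pos: "?D > 0"
    unfolding det_r by (intro prod_pos ballI zero_less_power mult_pos_pos sin_pos) auto
  then have "det (mat 1 - matrix \<sigma>) \<noteq> 0" by simp
  then have det_m: "det (mat 1 - matrix \<sigma>) = (\<Prod>d\<in>{d. d dvd p}. real d powi m d)"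
    by (rule char_poly_at_1[OF p _ assms(11)])
  \<comment> \<open>The spectrum yields only the absolute value of the determinant; nonnegativity of
    this product settles the sign.\<close>
  have "(\<Prod>d\<in>{d. d dvd p}. real d powi m d) \<ge> 0"
    by (intro prod_nonneg) simp
  then have det_m': "(\<Prod>d\<in>{d. d dvd p}. real d powi m d) = ?D"
    unfolding det_m by simp

  \<comment> \<open>What remains of the quotient of characters once dim T, the power of q and the
    theta series are split off.\<close>
  define F where "F t = euler_prod t 1 ^ ?l / (\<Prod>i\<in>?I. euler_prod t (real i / real p) ^ ?r i)" for t
  have F_pos: "F t > 0" if "t > 0" for t
    unfolding F_def using that i_range by (intro divide_pos_pos zero_less_power prod_pos ballI euler_prod_pos) auto
  have F_sq: "F t ^ 2 = (\<Prod>i\<in>?I. refl_prod t (real i / real p) ^ ?r i)" for t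
  proof -
    \<comment> \<open>Reversing i to p - i in one of the two denominators of the square creates the
      pairs x, 1 - x.\<close>
    have "(\<Prod>i\<in>?I. euler_prod t (real i / real p) ^ ?r i) = (\<Prod>i\<in>?I. euler_prod t (1 - real i / real p) ^ ?r i)"
    proof (rule prod.reindex_bij_witness[of _ "\<lambda>i. p - i" "\<lambda>i. p - i"])
      fix i assume i: "i \<in> ?I"
      then show "euler_prod t (1 - real (p - i) / real p) ^ ?r (p - i) = euler_prod t (real i / real p) ^ ?r i"
      proof -
        have "1 - real (p - i) / real p = real i / real p"
          using i_range(4)[OF i] by linarith
        moreover have "?r (p - i) = ?r i"
          using i p by (intro r_dim_symmetric) auto
        ultimately show ?thesis by (simp only:)
      qed
    qed (use p in auto)
    then have "F t ^ 2 = (euler_prod t 1 ^ ?l / (\<Prod>i\<in>?I. euler_prod t (real i / real p) ^ ?r i)) *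
        (euler_prod t 1 ^ ?l / (\<Prod>i\<in>?I. euler_prod t (1 - real i / real p) ^ ?r i))"
      by (simp add: F_def power2_eq_square)
    also have "euler_prod t 1 ^ ?l = (\<Prod>i\<in>?I. euler_prod t 1 ^ ?r i)"
      unfolding sum_r[symmetric] by (rule power_sum)
    finally have "F t ^ 2 = (\<Prod>i\<in>?I. (euler_prod t 1 ^ ?r i / euler_prod t (real i / real p) ^ ?r i) *
        (euler_prod t 1 ^ ?r i / euler_prod t (1 - real i / real p) ^ ?r i))"
      by (simp only: prod_dividef prod.distrib)
    also have "\<dots> = (\<Prod>i\<in>?I. refl_prod t (real i / real p) ^ ?r i)"
      by (intro prod.cong refl)
        (simp only: refl_prod_def power_divide power_mult_distrib power2_eq_square times_divide_times_eq)
    finally show ?thesis .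
  qed
  have F_sq_lim: "((\<lambda>t. t ^ ?l * F t ^ 2) \<longlongrightarrow> (2 * pi) ^ ?l / ?D) (at_right 0)"
  proof -
    \<comment> \<open>One factor t is available for each of the r_i copies, because the r_i add up
      to the rank.\<close>
    have "((\<lambda>t. \<Prod>i\<in>?I. (t * refl_prod t (real i / real p)) ^ ?r i) \<longlongrightarrow> (\<Prod>i\<in>?I. (pi / sin (pi * (real i / real p))) ^ ?r i)) (at_right 0)"
      by (intro tendsto_prod tendsto_power refl_prod_tendsto i_range)
    also have "(\<lambda>t. \<Prod>i\<in>?I. (t * refl_prod t (real i / real p)) ^ ?r i) = (\<lambda>t. t ^ ?l * F t ^ 2)"
      unfolding F_sq power_mult_distrib prod.distrib sum_r[symmetric] power_sum ..
    \<comment> \<open>Doubling numerator and denominator exhibits 2 sin (\<pi> i / p), the absolute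
      value of 1 - \<xi>^i.\<close>
    also have "(\<Prod>i\<in>?I. (pi / sin (pi * (real i / real p))) ^ ?r i) = (\<Prod>i\<in>?I. (2 * pi) ^ ?r i / (2 * sin (pi * (real i / real p))) ^ ?r i)"
      by (intro prod.cong refl) (simp add: power_divide power_mult_distrib)
    also have "\<dots> = (2 * pi) ^ ?l / ?D"
      unfolding prod_dividef det_r sum_r[symmetric] power_sum ..
    finally show ?thesis .
  qed
  have "((\<lambda>y. (2 * pi * y) ^ ?l * F (2 * pi * y) ^ 2) \<longlongrightarrow> (2 * pi) ^ ?l / ?D) (at_right 0)"
  proof (rule filterlim_compose[OF F_sq_lim])
    show "filterlim (\<lambda>y. 2 * pi * y) (at_right 0) (at_right (0::real))"
      by real_asymp
  qed
  then have "((\<lambda>y. (2 * pi * y) ^ ?l * F (2 * pi * y) ^ 2 / (2 * pi) ^ ?l) \<longlongrightarrow> (2 * pi) ^ ?l / ?D / (2 * pi) ^ ?l) (at_right 0)"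
    by (intro tendsto_divide tendsto_const) auto
  then have "((\<lambda>y. y ^ ?l * F (2 * pi * y) ^ 2) \<longlongrightarrow> 1 / ?D) (at_right 0)"
    by (simp add: power_mult_distrib)
  then have "((\<lambda>y. sqrt (y ^ ?l * F (2 * pi * y) ^ 2)) \<longlongrightarrow> sqrt (1 / ?D)) (at_right 0)"
    by (rule tendsto_real_sqrt)
  moreover have "\<forall>\<^sub>F y in at_right 0. sqrt (y ^ ?l * F (2 * pi * y) ^ 2) = sqrt y ^ ?l * F (2 * pi * y)"
    using eventually_at_right_less[of "0::real"]
  proof eventually_elim
    case (elim y)
    then show ?case using F_pos[of "2 * pi * y"] by (simp add: real_sqrt_mult real_sqrt_power)
  qed
  ultimately have F_lim: "((\<lambda>y. sqrt y ^ ?l * F (2 * pi * y)) \<longlongrightarrow> sqrt (1 / ?D)) (at_right 0)"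
    by (rule Lim_transform_eventually)
  have q_lim: "((\<lambda>y. qpow y (rho \<sigma> p)) \<longlongrightarrow> 1) (at_right 0)"
  proof -
    have "((\<lambda>y. exp (- 2 * pi * y * rho \<sigma> p)) \<longlongrightarrow> exp (- 2 * pi * 0 * rho \<sigma> p)) (at_right 0)"
      by (intro tendsto_intros)
    then show ?thesis by (simp add: qpow_def)
  qed
  have B_nz: "det B \<noteq> 0" using assms(1) by (simp add: invertible_det_nz)
  \<comment> \<open>The same power of sqrt y is inserted above and below, making both
    \<open>F\<close> and the theta series converge to nonzero limits.\<close>
  have "((\<lambda>y. real dimT * qpow y (rho \<sigma> p) * (sqrt y ^ ?l * F (2 * pi * y)) / (sqrt y ^ ?l * theta_L L y)) \<longlongrightarrow>
     real dimT * 1 * sqrt (1 / ?D) / (1 / \<bar>det B\<bar>)) (at_right 0)"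
    unfolding assms(2)
    by (intro tendsto_divide tendsto_mult tendsto_const q_lim F_lim theta_tendsto assms(1)) (use B_nz in simp)
  moreover have "\<forall>\<^sub>F y in at_right 0. real dimT * qpow y (rho \<sigma> p) * (sqrt y ^ ?l * F (2 * pi * y)) / (sqrt y ^ ?l * theta_L L y)
      = Z_VLT \<sigma> p dimT y / Z_VL L y"
    using eventually_at_right_less[of "0::real"]
  proof eventually_elim
    case (elim y)
    define P where "P = (\<Prod>i\<in>?I. euler_prod (2 * pi * y) (real i / real p) ^ ?r i)"
    \<comment> \<open>The powers q^(1/24) of the eta functions cancel the shift by - l/24 in the
      twisted character.\<close>
    have "qpow y (rho \<sigma> p) = qpow y (rho \<sigma> p - real ?l / 24) * qpow y (1/24) ^ ?l"
    proof -
      have "- 2 * pi * y * rho \<sigma> p = - 2 * pi * y * (rho \<sigma> p - real ?l / 24) + real ?l * (- 2 * pi * y * (1/24))"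
        by (simp add: algebra_simps)
      then show ?thesis
        unfolding qpow_def exp_of_nat_mult[symmetric] exp_add[symmetric] by (simp only:)
    qed
    then have "Z_VLT \<sigma> p dimT y / Z_VL L y = real dimT * qpow y (rho \<sigma> p) * F (2 * pi * y) / theta_L L y"
      unfolding Z_VLT_def Z_VL_def Z_M1_eq[OF elim p] eta_eq F_def P_def[symmetric]
      by (simp add: power_mult_distrib mult_ac)
    then show ?case using elim by simp
  qed
  ultimately have "((\<lambda>y. Z_VLT \<sigma> p dimT y / Z_VL L y) \<longlongrightarrow> real dimT * 1 * sqrt (1 / ?D) / (1 / \<bar>det B\<bar>)) (at_right 0)"
    by (rule Lim_transform_eventually)
  also have "real dimT * 1 * sqrt (1 / ?D) / (1 / \<bar>det B\<bar>) = \<bar>det B\<bar> * real dimT / sqrt ?D"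
    by (simp add: real_sqrt_divide)
  finally show ?thesis
    unfolding qdim_is_def det_m' .
qed

end
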